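(* Let $\mathbb{B}=(\mathbb{B}_\alpha,\|\cdot\|_\alpha)_{\alpha\in[\alpha_*,\alpha^*]}$ be a scale of Banach spaces, $T>0$, and suppose that conditions C1–C5 (listed in the context) are satisfied for $x_n,x$, $U_n,U$, $B_n,B$, where either ($\beta=0$ and $r\in(0,\infty]$) or ($\beta\in(0,\tfrac12)$ and $r=\infty$). Let $\alpha_0\in(\alpha_*,\alpha^* )$, $\gamma\in(\beta,1-\beta)$ and $\lambda>\lambda_1(\alpha_0,\gamma,r,T)$. Denote by $u$ the solution to $$u(t)=U(t,0)x+\int_0^tU(t,s)B(u(s),s)\,\mathrm{d}s$$ and by $u_n$, $n\in\mathbb{N}$, the solutions to $$u_n(t)=U_n(t,0)x_n+\int_0^tU_n(t,s)B_n(u_n(s),s)\,\mathrm{d}s$$ on the interval $[0,\frac{\alpha^*-\alpha_0}{\lambda})$ in the scale $(\mathbb{B}_\alpha)_{\alpha\in[\alpha_0,\alpha^*]}$ satisfying $\|u\|^{(\gamma)}<\infty$ and $\|u_n\|^{(\gamma)}<\infty$. Then, for each $\alpha\in(\alpha_0,\alpha^*]$ and $T'\in(0,\frac{\alpha-\alpha_0}{\lambda})$, $$\sup_{t\in[0,T']}\|u_n(t)-u(t)\|_\alpha\longrightarrow0,\qquad n\to\infty .$$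
   Context: Scale: $\mathbb{B}=(\mathbb{B}_\alpha,\|\cdot\|_\alpha)_{\alpha_*\le\alpha\le\alpha^*}$ are Banach spaces with $\mathbb{B}_{\alpha'}\subset\mathbb{B}_\alpha$ and $\|\cdot\|_\alpha\le\|\cdot\|_{\alpha'}$ for $\alpha'<\alpha$; $i_{\alpha'\alpha}$ is the embedding. $B_r^\alpha(x)=\{y\in\mathbb{B}_\alpha:\|y-x\|_\alpha\le r\}$ for $r\in(0,\infty)$, $B_\infty^\alpha(x)=\mathbb{B}_\alpha$. A nonlinear operator $L$ in the scale (relative to $r\in(0,\infty]$ and $x\in\mathbb{B}_{\alpha_*}$) is a collection of maps $L_{\alpha'\alpha}:B_r^{\alpha'}(x)\to\mathbb{B}_\alpha$, $\alpha_*\le\alpha'<\alpha\le\alpha^*$, with $L_{\alpha'\alpha''}y=i_{\alpha\alpha''}L_{\alpha'\alpha}y=L_{\alpha\alpha''}i_{\alpha'\alpha}y$ for $\alpha'<\alpha<\alpha''$ and $y\in B_r^{\alpha'}(x)$. It is a bounded linear operator in the scale if $r=\infty$ and every $L_{\alpha'\alpha}$ is a bounded linear operator $\mathbb{B}_{\alpha'}\to\mathbb{B}_\alpha$. Compositions are $(LK)_{\alpha'\alpha}=L_{\delta\alpha}K_{\alpha'\delta}$ for any $\delta\in(\alpha',\alpha)$. Subscripts are omitted. Conditions: C1. $x_n,x\in\mathbb{B}_{\alpha_*}$ with $x_n\to x$ in $\mathbb{B}_{\alpha_*}$. C2. $(V(t,s))_{0\le s\le t<T}$, for $V=U$ and for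 each $V=U_n$, $n\in\mathbb{N}$, is a family of bounded linear operators in the scale with $V(t,t)=1$ (the embedding), $V(t,q)V(q,s)=V(t,s)$ for $s\le q\le t$, $(t,s)\mapsto V(t,s)\in L(\mathbb{B}_{\alpha'},\mathbb{B}_\alpha)$ strongly continuous for all $\alpha'<\alpha$, and $\|V(t,s)\|_{L(\mathbb{B}_{\alpha'},\mathbb{B}_\alpha)}\le\frac{C_1}{(\alpha-\alpha')^\beta}$ for all $\alpha'<\alpha$, $0\le s\le t<T$, with $C_1>0$, $\beta\in[0,\frac12)$ independent of $n$. C3. For any $\alpha\in(\alpha_*,\alpha^*]$ there is $C(\alpha)>0$ with $\|U_n(t,0)x_n-U_n(s,0)x_n\|_\alpha\le C(\alpha)|t-s|$ for all $0\le s,t<T$, $n\in\mathbb{N}$. C4. With constants $r\in(0,\infty]$, $C_2,C_3>0$ independent of $n$: for $(D,y)=(B,x)$ and for each $(D,y)=(B_n,x_n)$, $(D(\cdot,t))_{t\in[0,T)}$ is a family of nonlinear operators in the scale (relative to $r$ and $y$) such that $B_r^{\alpha'}(y)\times[0,T)\ni(u,t)\mapsto D(u,t)\in\mathbb{B}_\alpha$ is jointly continuous for $\alpha'<\alpha$; $\|D(u,t)-D(v,t)\|_\alpha\le\frac{C_2}{(\alpha-\alpha')^{1-\beta}}\|u-v\|_{\alpha'}$ for $\alpha'<\alpha$, $t\in[0,T)$, $u,v\in B_r^{\alpha'}(y)$; and $\|D(y,t)\|_\alpha\le\frac{C_3}{\alpha-\alpha_*}$ for $t\in[0,T)$, $\alpha\in(\alpha_*,\alpha^*]$.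 C5. For all $\alpha'<\alpha$ in $[\alpha_*,\alpha^*]$ and each $z\in\mathbb{B}_{\alpha'}$: $U_n(t,s)z\to U(t,s)z$ in $\mathbb{B}_\alpha$ as $n\to\infty$, uniformly on compacts in $(t,s)$. If in addition $\|z-x\|_{\alpha'}\le r$, then $B_n(z,t)\to B(z,t)$ in $\mathbb{B}_\alpha$ as $n\to\infty$, uniformly on compacts in $t$ (understood along those $n$ for which $z$ lies in the domain $B_r^{\alpha'}(x_n)$ of $B_n(\cdot,t)$). Constants: for $y\in\{x\}\cup\{x_n:n\in\mathbb{N}\}$, with $C=C(\alpha_0)$ (which by C5 also serves as Lipschitz constant for $t\mapsto U(t,0)x$ in $\mathbb{B}_{\alpha_0}$) and $1/\infty:=0$, $\lambda_0(y,\alpha_0,\gamma,r,T)$ is the maximum of $$\frac{\alpha^*-\alpha_*}{T},\quad \frac{2^{2\gamma+1-\beta}C_1C_2}{\gamma-\beta},\quad \frac{4^{1-\beta}C_2(\alpha^*-\alpha_0)^\beta}{\gamma(1+\|y\|_{\alpha_*})}+\frac{2^{2+\gamma}C_1C_2}{\gamma},$$ $$\frac{C(\alpha^*-\alpha_0)}{r}+\frac{C_1\big(\frac{C_3}{\alpha_0-\alpha_*}+C\big)(\alpha^*-\alpha_0)(1+\|y\|_{\alpha_*})}{(1-\gamma)r},$$ and $\lambda_1(\alpha_0,\gamma,r,T)=\max\{\lambda_0(x,\alpha_0,\gamma,r,T),\ \sup_{n\in\mathbb{N}}\lambda_0(x_n,\alpha_0,\gamma,r,T)\}<\infty$. Put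 $T(\alpha)=\frac{\alpha-\alpha_0}{\lambda}$ and $\|u\|^{(\gamma)}=\sup_{\alpha\in(\alpha_0,\alpha^*]}\sup_{0\le t<T(\alpha)}(\alpha-\alpha_0-\lambda t)^\gamma\|u(t)\|_\alpha$. Solution: a solution to $u(t)=U(t,0)x+\int_0^tU(t,s)B(u(s),s)\,\mathrm{d}s$ on $[0,\frac{\alpha^*-\alpha_0}{\lambda})$ in the scale $(\mathbb{B}_\alpha)_{\alpha\in[\alpha_0,\alpha^*]}$ is a function $u:[0,T(\alpha^* ))\to\mathbb{B}_{\alpha^*}$ such that for all $\alpha\in(\alpha_0,\alpha^*]$: (i) $u|_{[0,T(\alpha))}\in C([0,T(\alpha));\mathbb{B}_\alpha)$ and $u(t)\in B_r^\alpha(x)$ for $t\in[0,T(\alpha))$; (ii) for each $t\in[0,T(\alpha))$ there are $\alpha'<\alpha''$ in $[\alpha_0,\alpha)$ with $t<T(\alpha')$ such that $u(t)=U_{\alpha_*\alpha}(t,0)x+\int_0^tU_{\alpha''\alpha}(t,s)B_{\alpha'\alpha''}(u(s),s)\,\mathrm{d}s$ in $\mathbb{B}_\alpha$. For $u_n$ the same definition is used with $x_n,U_n,B_n$ in place of $x,U,B$. Under the hypotheses of the claim, solutions with finite $\|\cdot\|^{(\gamma)}$ exist and are unique. *)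

theory Defs
  imports "HOL-Analysis.Analysis"
begin

section \<open>Scales of Banach spaces\<close>

text \<open>All spaces of a scale are linear subspaces of one ambient real vector space, so that the
  embeddings are inclusions. Only the indices in the interval from \<open>lo\<close> to \<open>hi\<close> matter, and
  \<open>nrm S \<alpha>\<close> is meaningful only on \<open>spc S \<alpha>\<close>.\<close>

record 'a scale =
  lo :: real
  hi :: real
  spc :: "real \<Rightarrow> 'a set"
  nrm :: "real \<Rightarrow> 'a \<Rightarrow> real"

text \<open>The locale \<open>Metric_space\<close> wants nonnegativity and symmetry also outside the carrier;
  hence the value 0 there.\<close>

definition norm_dist :: "'a::real_vector set \<Rightarrow> ('a \<Rightarrow> real) \<Rightarrow> 'a \<Rightarrow> 'a \<Rightarrow> real" where
  "norm_dist X N x y = (if x \<in> X \<and> y \<in> X then N (x - y) else 0)"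

definition norm_top :: "'a::real_vector set \<Rightarrow> ('a \<Rightarrow> real) \<Rightarrow> 'a topology" where
  "norm_top X N = Metric_space.mtopology X (norm_dist X N)"

definition banach_space_on :: "'a::real_vector set \<Rightarrow> ('a \<Rightarrow> real) \<Rightarrow> bool" where
  "banach_space_on X N \<longleftrightarrow>
     subspace X \<and>
     (\<forall>x\<in>X. 0 \<le> N x \<and> (N x = 0 \<longleftrightarrow> x = 0)) \<and>
     (\<forall>x\<in>X. \<forall>c. N (c *\<^sub>R x) = \<bar>c\<bar> * N x) \<and>
     (\<forall>x\<in>X. \<forall>y\<in>X. N (x + y) \<le> N x + N y) \<and>
     Metric_space.mcomplete X (norm_dist X N)"

definition banach_scale :: "'a::real_vector scale \<Rightarrow> bool" where
  "banach_scale S \<longleftrightarrow>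
     (\<forall>\<alpha>\<in>{lo S..hi S}. banach_space_on (spc S \<alpha>) (nrm S \<alpha>)) \<and>
     (\<forall>\<alpha>' \<alpha>. lo S \<le> \<alpha>' \<and> \<alpha>' < \<alpha> \<and> \<alpha> \<le> hi S \<longrightarrow>
        spc S \<alpha>' \<subseteq> spc S \<alpha> \<and> (\<forall>x\<in>spc S \<alpha>'. nrm S \<alpha> x \<le> nrm S \<alpha>' x))"

abbreviation scale_top :: "'a::real_vector scale \<Rightarrow> real \<Rightarrow> 'a topology" where
  "scale_top S \<alpha> \<equiv> norm_top (spc S \<alpha>) (nrm S \<alpha>)"

definition scale_ball :: "'a::real_vector scale \<Rightarrow> real \<Rightarrow> 'a \<Rightarrow> ereal \<Rightarrow> 'a set" where
  "scale_ball S \<alpha> x r = {y \<in> spc S \<alpha>. ereal (nrm S \<alpha> (y - x)) \<le> r}"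


section \<open>Operators in the scale\<close>

text \<open>An operator in the scale is a doubly indexed family; \<open>L \<alpha>' \<alpha>\<close> is the map
  from (a ball in) \<open>spc S \<alpha>'\<close> to \<open>spc S \<alpha>\<close>.\<close>

type_synonym 'a scale_map = "real \<Rightarrow> real \<Rightarrow> 'a \<Rightarrow> 'a"

definition nonlinear_operator ::
    "'a::real_vector scale \<Rightarrow> ereal \<Rightarrow> 'a \<Rightarrow> 'a scale_map \<Rightarrow> bool" where
  "nonlinear_operator S r x L \<longleftrightarrow>
     (\<forall>\<alpha>' \<alpha>. lo S \<le> \<alpha>' \<and> \<alpha>' < \<alpha> \<and> \<alpha> \<le> hi S \<longrightarrow>
        (\<forall>y\<in>scale_ball S \<alpha>' x r. L \<alpha>' \<alpha> y \<in> spc S \<alpha>)) \<and>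
     (\<forall>\<alpha>' \<alpha> \<alpha>''. lo S \<le> \<alpha>' \<and> \<alpha>' < \<alpha> \<and> \<alpha> < \<alpha>'' \<and> \<alpha>'' \<le> hi S \<longrightarrow>
        (\<forall>y\<in>scale_ball S \<alpha>' x r. L \<alpha>' \<alpha>'' y = L \<alpha>' \<alpha> y \<and> L \<alpha>' \<alpha>'' y = L \<alpha> \<alpha>'' y))"

text \<open>For infinite radius the ball is the whole space, whatever its centre.\<close>

definition bounded_linear_operator :: "'a::real_vector scale \<Rightarrow> 'a scale_map \<Rightarrow> bool" where
  "bounded_linear_operator S L \<longleftrightarrow>
     nonlinear_operator S \<infinity> 0 L \<and>
     (\<forall>\<alpha>' \<alpha>. lo S \<le> \<alpha>' \<and> \<alpha>' < \<alpha> \<and> \<alpha> \<le> hi S \<longrightarrow>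
        (\<forall>x\<in>spc S \<alpha>'. \<forall>y\<in>spc S \<alpha>'. L \<alpha>' \<alpha> (x + y) = L \<alpha>' \<alpha> x + L \<alpha>' \<alpha> y) \<and>
        (\<forall>c. \<forall>x\<in>spc S \<alpha>'. L \<alpha>' \<alpha> (c *\<^sub>R x) = c *\<^sub>R L \<alpha>' \<alpha> x) \<and>
        (\<exists>K. \<forall>x\<in>spc S \<alpha>'. nrm S \<alpha> (L \<alpha>' \<alpha> x) \<le> K * nrm S \<alpha>' x))"

definition scale_onorm :: "'a::real_vector scale \<Rightarrow> real \<Rightarrow> real \<Rightarrow> ('a \<Rightarrow> 'a) \<Rightarrow> ereal" where
  "scale_onorm S \<alpha>' \<alpha> A = (SUP x\<in>{x \<in> spc S \<alpha>'. nrm S \<alpha>' x \<le> 1}. ereal (nrm S \<alpha> (A x)))"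

definition time_simplex :: "real \<Rightarrow> (real \<times> real) set" where
  "time_simplex T = {(t, s). 0 \<le> s \<and> s \<le> t \<and> t < T}"

definition evolution_system ::
    "'a::real_vector scale \<Rightarrow> real \<Rightarrow> real \<Rightarrow> real \<Rightarrow> (real \<Rightarrow> real \<Rightarrow> 'a scale_map) \<Rightarrow> bool" where
  "evolution_system S T \<beta> C1 V \<longleftrightarrow>
     (\<forall>(t, s)\<in>time_simplex T. bounded_linear_operator S (V t s)) \<and>
     (\<forall>\<alpha>' \<alpha>. lo S \<le> \<alpha>' \<and> \<alpha>' < \<alpha> \<and> \<alpha> \<le> hi S \<longrightarrow>
        (\<forall>t\<in>{0..<T}. \<forall>y\<in>spc S \<alpha>'. V t t \<alpha>' \<alpha> y = y) \<and>
        (\<forall>s q t \<delta>. 0 \<le> s \<and> s \<le> q \<and> q \<le> t \<and> t < T \<and> \<alpha>' < \<delta> \<and> \<delta> < \<alpha> \<longrightarrow>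
           (\<forall>y\<in>spc S \<alpha>'. V t q \<delta> \<alpha> (V q s \<alpha>' \<delta> y) = V t s \<alpha>' \<alpha> y)) \<and>
        (\<forall>y\<in>spc S \<alpha>'. continuous_map (top_of_set (time_simplex T)) (scale_top S \<alpha>)
           (\<lambda>(t, s). V t s \<alpha>' \<alpha> y)) \<and>
        (\<forall>(t, s)\<in>time_simplex T.
           scale_onorm S \<alpha>' \<alpha> (V t s \<alpha>' \<alpha>) \<le> ereal (C1 / (\<alpha> - \<alpha>') powr \<beta>)))"

text \<open>\<open>D t\<close> is the operator usually written $D(\cdot,t)$.\<close>

definition nonlinearity ::
    "'a::real_vector scale \<Rightarrow> real \<Rightarrow> real \<Rightarrow> ereal \<Rightarrow> real \<Rightarrow> real \<Rightarrow> 'a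
      \<Rightarrow> (real \<Rightarrow> 'a scale_map) \<Rightarrow> bool" where
  "nonlinearity S T \<beta> r C2 C3 y D \<longleftrightarrow>
     (\<forall>t\<in>{0..<T}. nonlinear_operator S r y (D t)) \<and>
     (\<forall>\<alpha>' \<alpha>. lo S \<le> \<alpha>' \<and> \<alpha>' < \<alpha> \<and> \<alpha> \<le> hi S \<longrightarrow>
        continuous_map
          (subtopology (prod_topology (scale_top S \<alpha>') euclideanreal)
             (scale_ball S \<alpha>' y r \<times> {0..<T}))
          (scale_top S \<alpha>) (\<lambda>(u, t). D t \<alpha>' \<alpha> u) \<and>
        (\<forall>t\<in>{0..<T}. \<forall>u\<in>scale_ball S \<alpha>' y r. \<forall>v\<in>scale_ball S \<alpha>' y r.
           nrm S \<alpha> (D t \<alpha>' \<alpha> u - D t \<alpha>' \<alpha> v)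
             \<le> C2 / (\<alpha> - \<alpha>') powr (1 - \<beta>) * nrm S \<alpha>' (u - v))) \<and>
     (\<forall>t\<in>{0..<T}. \<forall>\<alpha>\<in>{lo S<..hi S}.
        nrm S \<alpha> (D t (lo S) \<alpha> y) \<le> C3 / (\<alpha> - lo S))"


section \<open>Solutions\<close>

text \<open>The Riemann integral over $[a,b]$ with respect to the norm \<open>N\<close> on \<open>X\<close>: this is
  \<open>has_integral\<close> with \<open>N\<close> in place of the norm of a type class and with constant gauges.
  The integrands in question are continuous.\<close>

definition has_riemann_integral_on ::
    "'a::real_vector set \<Rightarrow> ('a \<Rightarrow> real) \<Rightarrow> (real \<Rightarrow> 'a) \<Rightarrow> 'a \<Rightarrow> real \<Rightarrow> real \<Rightarrow> bool" where
  "has_riemann_integral_on X N f I a b \<longleftrightarrow>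
     I \<in> X \<and> (\<forall>s\<in>{a..b}. f s \<in> X) \<and>
     (\<forall>e>0. \<exists>d>0. \<forall>p. p tagged_division_of {a..b} \<and> (\<lambda>s. ball s d) fine p \<longrightarrow>
        N ((\<Sum>(s, K)\<in>p. measure lborel K *\<^sub>R f s) - I) < e)"

text \<open>\<open>lam\<close> is $\lambda$, so that $T(\alpha)$ is \<open>(\<alpha> - \<alpha>0) / lam\<close>.\<close>

definition solution ::
    "'a::real_vector scale \<Rightarrow> real \<Rightarrow> real \<Rightarrow> ereal \<Rightarrow> 'a \<Rightarrow> (real \<Rightarrow> real \<Rightarrow> 'a scale_map)
      \<Rightarrow> (real \<Rightarrow> 'a scale_map) \<Rightarrow> (real \<Rightarrow> 'a) \<Rightarrow> bool" where
  "solution S \<alpha>0 lam r x V D u \<longleftrightarrow>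
     (\<forall>t\<in>{0..<(hi S - \<alpha>0) / lam}. u t \<in> spc S (hi S)) \<and>
     (\<forall>\<alpha>\<in>{\<alpha>0<..hi S}.
        continuous_map (top_of_set {0..<(\<alpha> - \<alpha>0) / lam}) (scale_top S \<alpha>) u \<and>
        (\<forall>t\<in>{0..<(\<alpha> - \<alpha>0) / lam}. u t \<in> scale_ball S \<alpha> x r) \<and>
        (\<forall>t\<in>{0..<(\<alpha> - \<alpha>0) / lam}. \<exists>\<alpha>' \<alpha>''.
           \<alpha>0 \<le> \<alpha>' \<and> \<alpha>' < \<alpha>'' \<and> \<alpha>'' < \<alpha> \<and> t < (\<alpha>' - \<alpha>0) / lam \<and>
           (\<exists>I. has_riemann_integral_on (spc S \<alpha>) (nrm S \<alpha>)
                  (\<lambda>s. V t s \<alpha>'' \<alpha> (D s \<alpha>' \<alpha>'' (u s))) I 0 t \<and>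
                u t = V t 0 (lo S) \<alpha> x + I)))"

definition weighted_norm ::
    "'a scale \<Rightarrow> real \<Rightarrow> real \<Rightarrow> real \<Rightarrow> (real \<Rightarrow> 'a) \<Rightarrow> ereal" where
  "weighted_norm S \<alpha>0 lam \<gamma> u =
     (SUP \<alpha>\<in>{\<alpha>0<..hi S}. SUP t\<in>{0..<(\<alpha> - \<alpha>0) / lam}.
        ereal ((\<alpha> - \<alpha>0 - lam * t) powr \<gamma> * nrm S \<alpha> (u t)))"


section \<open>The constants\<close>

text \<open>Values in \<open>ereal\<close>, where division by \<open>\<infinity>\<close> gives 0. The argument \<open>C\<close> is
  the Lipschitz constant belonging to \<open>\<alpha>0\<close>.\<close>

definition lambda0 ::
    "'a scale \<Rightarrow> real \<Rightarrow> real \<Rightarrow> real \<Rightarrow> real \<Rightarrow> real \<Rightarrow> 'a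
      \<Rightarrow> real \<Rightarrow> real \<Rightarrow> ereal \<Rightarrow> real \<Rightarrow> ereal" where
  "lambda0 S \<beta> C1 C2 C3 C y \<alpha>0 \<gamma> r T = Max {
     ereal ((hi S - lo S) / T),
     ereal (2 powr (2 * \<gamma> + 1 - \<beta>) * C1 * C2 / (\<gamma> - \<beta>)),
     ereal (4 powr (1 - \<beta>) * C2 * (hi S - \<alpha>0) powr \<beta> / (\<gamma> * (1 + nrm S (lo S) y))
            + 2 powr (2 + \<gamma>) * C1 * C2 / \<gamma>),
     ereal (C * (hi S - \<alpha>0)) / r
       + ereal (C1 * (C3 / (\<alpha>0 - lo S) + C) * (hi S - \<alpha>0) * (1 + nrm S (lo S) y))
           / (ereal (1 - \<gamma>) * r)}"

definition lambda1 ::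
    "'a scale \<Rightarrow> real \<Rightarrow> real \<Rightarrow> real \<Rightarrow> real \<Rightarrow> real \<Rightarrow> 'a \<Rightarrow> (nat \<Rightarrow> 'a)
      \<Rightarrow> real \<Rightarrow> real \<Rightarrow> ereal \<Rightarrow> real \<Rightarrow> ereal" where
  "lambda1 S \<beta> C1 C2 C3 C x xs \<alpha>0 \<gamma> r T =
     max (lambda0 S \<beta> C1 C2 C3 C x \<alpha>0 \<gamma> r T)
         (SUP n. lambda0 S \<beta> C1 C2 C3 C (xs n) \<alpha>0 \<gamma> r T)"

end

theory Submission
  imports Defs
begin

text \<open>The weighted distance $\sup\,(\alpha-\alpha_0-\lambda t)^\gamma\|u_n(t)-u(t)\|_\alpha$ is finite
  because both weighted norms are. Estimating the two integral equations against each other, with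
  the gap $\alpha-\alpha_0-\lambda s$ at time $s$ split into the parts 1/2, 1/4, 1/4 (kept as weight,
  lost to the nonlinearity, lost to the evolution), bounds it by a consistency error plus
  $2^{2+\gamma}C_1C_2/(\lambda\gamma)$ times itself, and the third entry of $\lambda_0$ makes this
  factor smaller than 1.

  The consistency error is not uniformly small near the edge $t=T(\alpha)$. Replacing $\alpha_0$
  by $\alpha_0+\eta$ in the weight keeps away from the edge: there the functions $s\mapsto u(s)$ and
  $s\mapsto B(u(s),s)$ are locally continuous into one fixed space of the scale, and C5 becomes
  uniform by compactness of the time interval.\<close>

text \<open>The integral equation supplies one pair of intermediate indices for a whole integral,
  whereas the estimate must adapt the pair to the time s. Values in a scale do not depend on the
  indices through which they are computed, so at time s the pair may be \<open>d - 2 * h\<close> and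
  \<open>d - h\<close>, with h a quarter of the remaining gap \<rho>. The bounds of evolution and
  nonlinearity then multiply to C1 C2 / h = 4 C1 C2 / \<rho>, the exponent \<beta> cancelling, and
  the weight at half the gap contributes 2^\<gamma> \<rho>^(-\<gamma>). Integrating
  \<rho>^(-1-\<gamma>) in time divides by \<lambda> \<gamma>; this is the origin of the contraction
  constant.

  A second obstacle is the domain: B_n lives on a ball around x_n and B on one around x, and neither
  solution need lie in the other ball. The comparison therefore passes through
  \<open>pull (1 - e) s\<close>, which lies in both balls for large n. It differs from u(s) by e
  times u(s) - x, a quantity that the weighted norm controls once the edge is avoided.\<close>

section \<open>Norms on a subspace\<close>

context
  fixes X :: "'a::real_vector set" and N :: "'a \<Rightarrow> real"
  assumes X: "banach_space_on X N"
begin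

lemma banach_subspace: "subspace X"
  using X by (simp add: banach_space_on_def)

lemma banach_diff: "y \<in> X \<Longrightarrow> z \<in> X \<Longrightarrow> y - z \<in> X"
  using banach_subspace by (rule subspace_diff)

lemma norm_on_nonneg: "y \<in> X \<Longrightarrow> 0 \<le> N y"
  using X by (simp add: banach_space_on_def)

lemma norm_on_eq_0: "y \<in> X \<Longrightarrow> N y = 0 \<longleftrightarrow> y = 0"
  using X by (simp add: banach_space_on_def)

lemma norm_on_scaleR: "y \<in> X \<Longrightarrow> N (c *\<^sub>R y) = \<bar>c\<bar> * N y"
  using X by (simp add: banach_space_on_def)

lemma norm_on_triangle: "y \<in> X \<Longrightarrow> z \<in> X \<Longrightarrow> N (y + z) \<le> N y + N z"
  using X by (simp add: banach_space_on_def)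

lemma norm_on_minus_commute: "y \<in> X \<Longrightarrow> z \<in> X \<Longrightarrow> N (y - z) = N (z - y)"
  using norm_on_scaleR[of "y - z" "-1"] banach_diff by simp

lemma norm_on_triangle_minus: "y \<in> X \<Longrightarrow> z \<in> X \<Longrightarrow> N (y - z) \<le> N y + N z"
  using norm_on_triangle[of y "- z"] norm_on_scaleR[of z "-1"] subspace_neg[OF banach_subspace, of z] by simp

lemma norm_on_dist_triangle:
  "y \<in> X \<Longrightarrow> z \<in> X \<Longrightarrow> w \<in> X \<Longrightarrow> N (y - w) \<le> N (y - z) + N (z - w)"
  using norm_on_triangle[of "y - z" "z - w"] banach_diff by simp

lemma norm_on_sum: "(\<And>i. i \<in> A \<Longrightarrow> f i \<in> X) \<Longrightarrow> N (\<Sum>i\<in>A. f i) \<le> (\<Sum>i\<in>A. N (f i))"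
proof (induction A rule: infinite_finite_induct)
  case (insert a A)
  have "N (f a + sum f A) \<le> N (f a) + N (sum f A)"
    using insert by (intro norm_on_triangle subspace_sum[OF banach_subspace]) auto
  then show ?case
    using insert by fastforce
qed (use norm_on_eq_0[of 0] subspace_0[OF banach_subspace] in auto)

lemma Metric_space_norm_dist: "Metric_space X (norm_dist X N)"
proof
  fix y z w
  show "0 \<le> norm_dist X N y z" "norm_dist X N y z = norm_dist X N z y"
    using norm_on_nonneg banach_diff norm_on_minus_commute by (auto simp: norm_dist_def)
  show "(norm_dist X N y z = 0) = (y = z)" if "y \<in> X" "z \<in> X"
    using that norm_on_eq_0 banach_diff by (auto simp: norm_dist_def)
  show "norm_dist X N y w \<le> norm_dist X N y z + norm_dist X N z w"
    if "y \<in> X" "z \<in> X" "w \<in> X"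
    using that norm_on_dist_triangle by (auto simp: norm_dist_def)
qed

lemma topspace_norm_top: "topspace (norm_top X N) = X"
  unfolding norm_top_def by (rule Metric_space.topspace_mtopology[OF Metric_space_norm_dist])

lemma limitin_norm_top:
  assumes "limitin (norm_top X N) f l F" "0 < e"
  shows "\<forall>\<^sub>F i in F. N (f i - l) < e"
proof -
  have "l \<in> X" "\<forall>\<^sub>F i in F. f i \<in> X \<and> norm_dist X N (f i) l < e"
    using assms Metric_space.limitin_metric[OF Metric_space_norm_dist]
    unfolding norm_top_def by blast+
  then show ?thesis
    by (auto simp: norm_dist_def elim: eventually_mono)
qed

lemma continuous_map_norm_top:
  fixes f :: "'b::metric_space \<Rightarrow> 'a"
  assumes f: "continuous_map (top_of_set A) (norm_top X N) f" and a: "a \<in> A" and e: "0 < e"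
  shows "\<exists>d>0. \<forall>s\<in>A. dist s a < d \<longrightarrow> N (f s - f a) < e"
proof -
  interpret Metric_space X "norm_dist X N"
    by (rule Metric_space_norm_dist)
  have fX: "f s \<in> X" if "s \<in> A" for s
    using continuous_map_image_subset_topspace[OF f] that topspace_norm_top by auto
  have "openin (norm_top X N) (mball (f a) e)"
    unfolding norm_top_def by (rule openin_mball)
  then have "openin (top_of_set A) {s \<in> topspace (top_of_set A). f s \<in> mball (f a) e}"
    using f openin_continuous_map_preimage by blast
  then obtain d where "d > 0" "\<And>s. s \<in> A \<Longrightarrow> dist s a < d \<Longrightarrow> f s \<in> mball (f a) e"
    unfolding openin_euclidean_subtopology_iff using fX a e by force
  then show ?thesis
    using fX a e norm_on_minus_commute by (auto simp: norm_dist_def intro!: exI[of _ d])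
qed

text \<open>One tagged division, fine for both constant gauges and for the gauge of
  \<open>h\<close>, serves all three Riemann sums, and the pointwise bound is applied at its tags.
  With an explicit majorant \<open>h\<close> the question whether \<open>N (f s - g s)\<close> is
  integrable never arises.\<close>

lemma riemann_integral_diff_bound:
  assumes f: "has_riemann_integral_on X N f I a b"
    and g: "has_riemann_integral_on X N g J a b"
    and h: "(h has_integral H) {a..b}"
    and le: "\<And>s. s \<in> {a..b} \<Longrightarrow> N (f s - g s) \<le> h s"
  shows "N (I - J) \<le> H"
proof (rule field_le_epsilon)
  fix e :: real assume "0 < e"
  then have e: "0 < e / 3" by simp
  have X': "I \<in> X" "J \<in> X" "\<And>s. s \<in> {a..b} \<Longrightarrow> f s \<in> X" "\<And>s. s \<in> {a..b} \<Longrightarrow> g s \<in> X"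
    using f g unfolding has_riemann_integral_on_def by auto
  obtain d1 where d1: "d1 > 0" "\<And>p. p tagged_division_of {a..b} \<Longrightarrow> (\<lambda>s. ball s d1) fine p \<Longrightarrow>
      N ((\<Sum>(s, K)\<in>p. measure lborel K *\<^sub>R f s) - I) < e / 3"
    using f e unfolding has_riemann_integral_on_def by meson
  obtain d2 where d2: "d2 > 0" "\<And>p. p tagged_division_of {a..b} \<Longrightarrow> (\<lambda>s. ball s d2) fine p \<Longrightarrow>
      N ((\<Sum>(s, K)\<in>p. measure lborel K *\<^sub>R g s) - J) < e / 3"
    using g e unfolding has_riemann_integral_on_def by meson
  obtain G where G: "gauge G" "\<And>p. p tagged_division_of {a..b} \<Longrightarrow> G fine p \<Longrightarrow>
      norm ((\<Sum>(s, K)\<in>p. measure lborel K *\<^sub>R h s) - H) < e / 3"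
    using h e unfolding has_integral_real by meson
  have "gauge (\<lambda>s. (ball s d1 \<inter> ball s d2) \<inter> G s)"
    using d1(1) d2(1) G(1) by (intro gauge_Int gauge_ball)
  then obtain p where p: "p tagged_division_of {a..b}"
      and "(\<lambda>s. (ball s d1 \<inter> ball s d2) \<inter> G s) fine p"
    by (rule fine_division_exists_real)
  then have fine: "(\<lambda>s. ball s d1) fine p" "(\<lambda>s. ball s d2) fine p" "G fine p"
    by (simp_all add: fine_Int)
  have tag: "s \<in> {a..b}" if "(s, K) \<in> p" for s K
    using tagged_division_ofD(2,3)[OF p that] by blast
  define F where "F = (\<Sum>(s, K)\<in>p. measure lborel K *\<^sub>R f s)"
  define E where "E = (\<Sum>(s, K)\<in>p. measure lborel K *\<^sub>R g s)"
  have FE: "F \<in> X" "E \<in> X"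
    unfolding F_def E_def using X' tag
    by (auto intro!: subspace_sum[OF banach_subspace] subspace_scale[OF banach_subspace])
  have "F - E = (\<Sum>(s, K)\<in>p. measure lborel K *\<^sub>R (f s - g s))"
    unfolding F_def E_def sum_subtractf[symmetric]
    by (intro sum.cong) (auto simp: scaleR_diff_right)
  also have "N \<dots> \<le> (\<Sum>(s, K)\<in>p. N (measure lborel K *\<^sub>R (f s - g s)))"
    unfolding case_prod_unfold using X' tag
    by (intro norm_on_sum subspace_scale[OF banach_subspace] banach_diff) auto
  also have "\<dots> \<le> (\<Sum>(s, K)\<in>p. measure lborel K *\<^sub>R h s)"
    using X' tag le by (intro sum_mono) (auto simp: norm_on_scaleR banach_diff mult_left_mono)
  also have "\<dots> \<le> H + e / 3"
    using G(2)[OF p fine(3)] unfolding real_norm_def real_scaleR_def by linarith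
  finally have FE': "N (F - E) \<le> H + e / 3" .
  have "N (F - I) < e / 3" "N (E - J) < e / 3"
    unfolding F_def E_def using d1(2)[OF p fine(1)] d2(2)[OF p fine(2)] by auto
  moreover have "N (I - J) \<le> N (I - F) + N (F - J)" "N (F - J) \<le> N (F - E) + N (E - J)"
    using X' FE by (intro norm_on_dist_triangle; simp)+
  ultimately show "N (I - J) \<le> H + e"
    using FE' norm_on_minus_commute[of I F] X' FE by simp
qed

end

section \<open>Congruence of integrals, an explicit primitive, and uniformity by compactness\<close>

lemma has_riemann_integral_on_cong:
  assumes "\<And>s. s \<in> {a..b} \<Longrightarrow> f s = g s" and f: "has_riemann_integral_on X N f I a b"
  shows "has_riemann_integral_on X N g I a b"
proof -
  have sum_eq: "(\<Sum>(s, K)\<in>p. measure lborel K *\<^sub>R f s) = (\<Sum>(s, K)\<in>p. measure lborel K *\<^sub>R g s)"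
    if p: "p tagged_division_of {a..b}" for p
  proof (rule sum.cong[OF refl])
    fix i assume "i \<in> p"
    then have "fst i \<in> {a..b}"
      using tagged_division_ofD(2,3)[OF p, of "fst i" "snd i"] by auto
    then show "(case i of (s, K) \<Rightarrow> measure lborel K *\<^sub>R f s) = (case i of (s, K) \<Rightarrow> measure lborel K *\<^sub>R g s)"
      using assms(1) by (simp add: case_prod_unfold)
  qed
  show ?thesis
    unfolding has_riemann_integral_on_def
  proof (intro conjI allI impI)
    show "I \<in> X" "\<forall>s\<in>{a..b}. g s \<in> X"
      using f assms(1) unfolding has_riemann_integral_on_def by auto
    fix e :: real assume "0 < e"
    then obtain d where d: "0 < d" "\<And>p. p tagged_division_of {a..b} \<Longrightarrow> (\<lambda>s. ball s d) fine p \<Longrightarrow>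
        N ((\<Sum>(s, K)\<in>p. measure lborel K *\<^sub>R f s) - I) < e"
      using f unfolding has_riemann_integral_on_def by meson
    show "\<exists>d>0. \<forall>p. p tagged_division_of {a..b} \<and> (\<lambda>s. ball s d) fine p \<longrightarrow>
        N ((\<Sum>(s, K)\<in>p. measure lborel K *\<^sub>R g s) - I) < e"
      using d sum_eq by (intro exI[of _ d]) metis
  qed
qed

text \<open>A primitive of the power -1-g of the shrinking gap is its power -g divided by l g.
  Integration in time thus gains one order of the singularity at the price of the factor 1/(l
  g).\<close>

lemma has_integral_powr_linear:
  fixes c g l t :: real
  assumes "0 < g" "0 < l" "0 \<le> t" "l * t < c"
  shows "((\<lambda>s. (c - l * s) powr (- 1 - g)) has_integral
    (c - l * t) powr - g / (l * g) - c powr - g / (l * g)) {0..t}"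
proof -
  have "((\<lambda>s. (c - l * s) powr - g / (l * g)) has_vector_derivative
      (c - l * s) powr (- 1 - g)) (at s within {0..t})" if s: "s \<in> {0..t}" for s
  proof -
    have "l * s \<le> l * t"
      using s assms by (intro mult_left_mono) auto
    then have "c - l * s > 0"
      using assms by linarith
    then have "((\<lambda>s. (c - l * s) powr - g / (l * g)) has_real_derivative
        (c - l * s) powr (- 1 - g)) (at s within {0..t})"
      using assms by (auto intro!: derivative_eq_intros simp: powr_diff powr_minus field_simps)
    then show ?thesis
      by (simp add: has_real_derivative_iff_has_vector_derivative)
  qed
  from fundamental_theorem_of_calculus[OF assms(3) this] show ?thesis
    by simp
qed

text \<open>A finite subcover leaves finitely many eventual properties to intersect. It is used on a
  compact time interval, because C5 speaks of a fixed vector z while the estimates involve a vector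
  moving with time.\<close>

lemma eventually_ball_compact:
  assumes "compact K"
    and loc: "\<And>a. a \<in> K \<Longrightarrow> \<exists>W. open W \<and> a \<in> W \<and> (\<forall>\<^sub>F n in F. \<forall>s\<in>W \<inter> K. P n s)"
  shows "\<forall>\<^sub>F n in F. \<forall>s\<in>K. P n s"
proof -
  obtain W where W: "\<And>a. a \<in> K \<Longrightarrow> open (W a) \<and> a \<in> W a \<and> (\<forall>\<^sub>F n in F. \<forall>s\<in>W a \<inter> K. P n s)"
    using loc by metis
  obtain K' where K': "K' \<subseteq> K" "finite K'" "K \<subseteq> (\<Union>a\<in>K'. W a)"
    using compactE_image[OF assms(1), of K W] W by blast
  have "\<forall>\<^sub>F n in F. \<forall>a\<in>K'. \<forall>s\<in>W a \<inter> K. P n s"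
    using K' W by (intro eventually_ball_finite) auto
  then show ?thesis
    by eventually_elim (use K' in blast)
qed

section \<open>Operators in a scale\<close>

context
  fixes S :: "'a::real_vector scale"
  assumes S: "banach_scale S"
begin

lemma banach_space_on_spc: "lo S \<le> a \<Longrightarrow> a \<le> hi S \<Longrightarrow> banach_space_on (spc S a) (nrm S a)"
  using S by (simp add: banach_scale_def)

lemma spc_mono: "lo S \<le> a \<Longrightarrow> a \<le> b \<Longrightarrow> b \<le> hi S \<Longrightarrow> y \<in> spc S a \<Longrightarrow> y \<in> spc S b"
  using S unfolding banach_scale_def by (cases "a = b") (simp, meson less_eq_real_def subsetD)

lemma nrm_mono:
  "lo S \<le> a \<Longrightarrow> a \<le> b \<Longrightarrow> b \<le> hi S \<Longrightarrow> y \<in> spc S a \<Longrightarrow> nrm S b y \<le> nrm S a y"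
  using S unfolding banach_scale_def by (cases "a = b") auto

text \<open>Compatibility only relates increasing triples of indices. Starting from the smaller
  source, which lies below both targets, first the target is exchanged and then the source.\<close>

lemma nonlinear_operator_indep:
  assumes L: "nonlinear_operator S r c L"
    and a: "lo S \<le> a" "a < b" "b \<le> hi S" "y \<in> scale_ball S a c r"
    and a': "lo S \<le> a'" "a' < b'" "b' \<le> hi S" "y \<in> scale_ball S a' c r"
  shows "L a b y = L a' b' y"
proof -
  have target: "L a b y = L a b' y"
    if "lo S \<le> a" "a < b" "b \<le> hi S" "a < b'" "b' \<le> hi S" "y \<in> scale_ball S a c r" for a b b'
  proof -
    have *: "L a q y = L a p y" if "a < p" "p < q" "q \<le> hi S" for p q
      using L \<open>lo S \<le> a\<close> \<open>y \<in> scale_ball S a c r\<close> that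
      unfolding nonlinear_operator_def by blast
    show ?thesis
      using *[of b b'] *[of b' b] that by (cases b b' rule: linorder_cases) auto
  qed
  have source: "L a b y = L a' b y"
    if "lo S \<le> a" "a < a'" "a' < b" "b \<le> hi S" "y \<in> scale_ball S a c r" for a a' b
    using L that unfolding nonlinear_operator_def by blast
  show ?thesis
    using linorder_less_linear[of a a']
  proof (elim disjE)
    assume "a < a'"
    then show ?thesis
      using target[of a b b'] source[of a a' b'] a a' by simp
  next
    assume "a = a'"
    then show ?thesis
      using target[of a b b'] a a' by simp
  next
    assume "a' < a"
    then show ?thesis
      using target[of a' b' b] source[of a' a b] a a' by simp
  qed
qed

section \<open>Evolution systems: linearity, index independence, bounds\<close>

context
  fixes T \<beta> C1 :: real and V :: "real \<Rightarrow> real \<Rightarrow> 'a scale_map" and t s :: real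
  assumes V: "evolution_system S T \<beta> C1 V" and ts: "0 \<le> s" "s \<le> t" "t < T"
begin

lemma evolution_linear: "bounded_linear_operator S (V t s)"
  using V ts by (auto simp: evolution_system_def time_simplex_def)

lemma evolution_indep:
  assumes "lo S \<le> a" "a < b" "b \<le> hi S" "y \<in> spc S a"
    and "lo S \<le> a'" "a' < b'" "b' \<le> hi S" "y \<in> spc S a'"
  shows "V t s a b y = V t s a' b' y"
  using evolution_linear assms
  by (intro nonlinear_operator_indep[of \<infinity> 0])
    (auto simp: bounded_linear_operator_def scale_ball_def)

lemma evolution_in_spc:
  "lo S \<le> a \<Longrightarrow> a < b \<Longrightarrow> b \<le> hi S \<Longrightarrow> y \<in> spc S a \<Longrightarrow> V t s a b y \<in> spc S b"
  using evolution_linear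
  by (auto simp: bounded_linear_operator_def nonlinear_operator_def scale_ball_def)

lemma evolution_diff:
  assumes "lo S \<le> a" "a < b" "b \<le> hi S" "y \<in> spc S a" "z \<in> spc S a"
  shows "V t s a b (y - z) = V t s a b y - V t s a b z"
proof -
  have "V t s a b (p + q) = V t s a b p + V t s a b q" if "p \<in> spc S a" "q \<in> spc S a" for p q
    using evolution_linear assms(1-3) that unfolding bounded_linear_operator_def by blast
  from this[of "y - z" z] show ?thesis
    using banach_diff[OF banach_space_on_spc] assms by simp
qed

lemma evolution_bound:
  assumes a: "lo S \<le> a" "a < b" "b \<le> hi S" and y: "y \<in> spc S a"
  shows "nrm S b (V t s a b y) \<le> C1 / (b - a) powr \<beta> * nrm S a y"
proof (cases "nrm S a y = 0")
  case True
  have Ba: "banach_space_on (spc S a) (nrm S a)" and Bb: "banach_space_on (spc S b) (nrm S b)"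
    using a by (auto intro: banach_space_on_spc)
  have "y = 0"
    using True norm_on_eq_0[OF Ba y] by simp
  then have "V t s a b y = 0"
    using evolution_diff[OF a y y] by simp
  then show ?thesis
    using True norm_on_eq_0[OF Bb evolution_in_spc[OF a y]] by simp
next
  case False
  have Ba: "banach_space_on (spc S a) (nrm S a)" and Bb: "banach_space_on (spc S b) (nrm S b)"
    using a by (auto intro: banach_space_on_spc)
  have pos: "0 < nrm S a y"
    using False norm_on_nonneg[OF Ba y] by simp
  define y' where "y' = (1 / nrm S a y) *\<^sub>R y"
  have y': "y' \<in> spc S a" "nrm S a y' = 1"
    using pos y by (auto simp: y'_def norm_on_scaleR[OF Ba] subspace_scale[OF banach_subspace[OF Ba]])
  have "ereal (nrm S b (V t s a b y')) \<le> scale_onorm S a b (V t s a b)"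
    unfolding scale_onorm_def by (rule SUP_upper) (use y' in simp)
  also have "\<dots> \<le> ereal (C1 / (b - a) powr \<beta>)"
    using V a ts by (auto simp: evolution_system_def time_simplex_def)
  finally have "nrm S b (V t s a b y') \<le> C1 / (b - a) powr \<beta>"
    by simp
  moreover have "V t s a b y' = (1 / nrm S a y) *\<^sub>R V t s a b y"
    using evolution_linear a y unfolding y'_def bounded_linear_operator_def by blast
  ultimately show ?thesis
    using pos norm_on_scaleR[OF Bb evolution_in_spc[OF a y]] by (simp add: field_simps)
qed

lemma evolution_diff_bound:
  assumes a: "lo S \<le> a" "a < b" "b \<le> hi S" and y: "y \<in> spc S a" "z \<in> spc S a"
  shows "nrm S b (V t s a b y - V t s a b z) \<le> C1 / (b - a) powr \<beta> * nrm S a (y - z)"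
  using evolution_bound[OF a, of "y - z"] evolution_diff[OF a y]
    banach_diff[OF banach_space_on_spc, of a y z] a y by simp

end

section \<open>Nonlinearities and their composition with an evolution\<close>

context
  fixes T \<beta> C2 C3 :: real and r :: ereal and c :: 'a and D :: "real \<Rightarrow> 'a scale_map" and s :: real
  assumes D: "nonlinearity S T \<beta> r C2 C3 c D" and s: "0 \<le> s" "s < T"
begin

lemma nonlinearity_in_spc:
  "lo S \<le> a \<Longrightarrow> a < b \<Longrightarrow> b \<le> hi S \<Longrightarrow> y \<in> scale_ball S a c r \<Longrightarrow> D s a b y \<in> spc S b"
  using D s unfolding nonlinearity_def nonlinear_operator_def by (simp add: Ball_def)

lemma nonlinearity_indep:
  assumes "lo S \<le> a" "a < b" "b \<le> hi S" "y \<in> scale_ball S a c r"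
    and "lo S \<le> a'" "a' < b'" "b' \<le> hi S" "y \<in> scale_ball S a' c r"
  shows "D s a b y = D s a' b' y"
  using assms D s by (intro nonlinear_operator_indep[of r c]) (auto simp: nonlinearity_def)

lemma nonlinearity_lipschitz:
  assumes "lo S \<le> a" "a < b" "b \<le> hi S" "y \<in> scale_ball S a c r" "z \<in> scale_ball S a c r"
  shows "nrm S b (D s a b y - D s a b z) \<le> C2 / (b - a) powr (1 - \<beta>) * nrm S a (y - z)"
  using assms D s unfolding nonlinearity_def by (simp add: Ball_def)

text \<open>Both intermediate indices can be exchanged at once, which is what permits indices
  depending on s under the integral.\<close>

lemma evolution_nonlinearity_indep:
  assumes V: "evolution_system S T \<beta> C1 V" "s \<le> t" "t < T"
    and a: "lo S \<le> a" "a < b" "b < d" "d \<le> hi S" "y \<in> scale_ball S a c r"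
    and a': "lo S \<le> a'" "a' < b'" "b' < d" "y \<in> scale_ball S a' c r"
  shows "V t s b d (D s a b y) = V t s b' d (D s a' b' y)"
proof -
  have "D s a b y = D s a' b' y"
    using a a' by (intro nonlinearity_indep) auto
  moreover have "D s a b y \<in> spc S b" "D s a' b' y \<in> spc S b'"
    using a a' by (auto intro!: nonlinearity_in_spc)
  ultimately show ?thesis
    using a a' evolution_indep[OF V(1) s(1) V(2,3), of b d _ b' d] by simp
qed

text \<open>Nonlinearity and evolution each lose the same index distance h, so that h^(-\<beta>) and
  h^(-(1-\<beta>)) multiply to 1/h whatever \<beta> is.\<close>

lemma evolution_nonlinearity_lipschitz:
  assumes V: "evolution_system S T \<beta> C1 V" "s \<le> t" "t < T" and C1: "0 \<le> C1"
    and h: "0 < h" "lo S \<le> d - 2 * h" "d \<le> hi S"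
    and y: "y \<in> scale_ball S (d - 2 * h) c r" "z \<in> scale_ball S (d - 2 * h) c r"
  shows "nrm S d (V t s (d - h) d (D s (d - 2 * h) (d - h) y) - V t s (d - h) d (D s (d - 2 * h) (d - h) z))
    \<le> C1 * C2 / h * nrm S (d - 2 * h) (y - z)" (is "?l \<le> _")
proof -
  have "?l \<le> C1 / h powr \<beta> * nrm S (d - h) (D s (d - 2 * h) (d - h) y - D s (d - 2 * h) (d - h) z)"
    using evolution_diff_bound[OF V(1) s(1) V(2,3), of "d - h" d
        "D s (d - 2 * h) (d - h) y" "D s (d - 2 * h) (d - h) z"] h y nonlinearity_in_spc
    by simp
  also have "\<dots> \<le> C1 / h powr \<beta> * (C2 / h powr (1 - \<beta>) * nrm S (d - 2 * h) (y - z))"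
    using nonlinearity_lipschitz[of "d - 2 * h" "d - h" y z] h y C1
    by (intro mult_left_mono) auto
  also have "\<dots> = C1 * C2 / h * nrm S (d - 2 * h) (y - z)"
    using h by (simp add: powr_diff)
  finally show ?thesis .
qed

end

lemma nonlinearity_continuous_time:
  assumes D: "nonlinearity S T \<beta> r C2 C3 c D"
    and a: "lo S \<le> a" "a < b" "b \<le> hi S" "y \<in> scale_ball S a c r"
  shows "continuous_map (top_of_set {0..<T}) (scale_top S b) (\<lambda>s. D s a b y)"
proof -
  have B: "banach_space_on (spc S a) (nrm S a)"
    using a by (auto intro: banach_space_on_spc)
  have D': "continuous_map (subtopology (prod_topology (scale_top S a) euclideanreal)
      (scale_ball S a c r \<times> {0..<T})) (scale_top S b) (\<lambda>(u, t). D t a b u)"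
    using D a unfolding nonlinearity_def by blast
  have "continuous_map (top_of_set {0..<T}) (subtopology (prod_topology (scale_top S a) euclideanreal)
      (scale_ball S a c r \<times> {0..<T})) (\<lambda>s. (y, s))"
    using a topspace_norm_top[OF B]
    by (auto simp: continuous_map_in_subtopology continuous_map_pairwise o_def scale_ball_def
        intro: continuous_map_from_subtopology)
  from continuous_map_compose[OF this D'] show ?thesis
    by (simp add: o_def)
qed

end

section \<open>Stability of the weighted distance\<close>

text \<open>Here c stands for C1 C2, \<rho> for the gap and D for its largest value; the left-hand
  side is the integrand bound with h = \<rho>/4. The term in M already has order -1-g, with constant
  4 * 2^g. The error terms are less singular, and \<rho> \<le> D raises them to the same order at
  the cost of a power of D; the 8 comes from two terms with factor 4 each.\<close>

lemma contraction_majorant: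
  fixes c M K e D g \<rho> :: real
  assumes "0 < \<rho>" "\<rho> \<le> D" "0 < g" "0 \<le> c" "0 \<le> K" "0 \<le> e"
  shows "c / (\<rho> / 4) * (M * (\<rho> / 2) powr - g + e * K) + e + c / (\<rho> / 4) * (e * K) + e
    \<le> (2 powr (2 + g) * c * M + e * (8 * c * K * D powr g + 2 * D powr (1 + g))) * \<rho> powr (- 1 - g)"
proof -
  have split: "\<rho> powr (- 1 - g) = \<rho> powr - g / \<rho>"
    using assms by (simp add: powr_diff powr_minus field_simps)
  have "(\<rho> / 2) powr - g = 2 powr g * \<rho> powr - g"
    using assms by (simp add: powr_divide powr_minus field_simps)
  then have 1: "c / (\<rho> / 4) * (M * (\<rho> / 2) powr - g) = 2 powr (2 + g) * c * M * \<rho> powr (- 1 - g)"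
    using assms by (simp add: split powr_add field_simps)
  have *: "1 \<le> D powr p * \<rho> powr - p" if "0 \<le> p" for p
    using powr_mono2[of p \<rho> D] that assms by (simp add: powr_minus field_simps)
  have "8 * c * e * K / \<rho> * 1 \<le> 8 * c * e * K / \<rho> * (D powr g * \<rho> powr - g)"
    using assms by (intro mult_left_mono *) auto
  then have 2: "c / (\<rho> / 4) * (e * K) + c / (\<rho> / 4) * (e * K)
      \<le> e * (8 * c * K * D powr g) * \<rho> powr (- 1 - g)"
    unfolding split by (simp add: field_simps)
  have "2 * e * 1 \<le> 2 * e * (D powr (1 + g) * \<rho> powr - (1 + g))"
    using assms by (intro mult_left_mono *) auto
  then have 3: "2 * e \<le> e * (2 * D powr (1 + g)) * \<rho> powr (- 1 - g)"
    by simp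
  from 1 2 3 show ?thesis
    by (simp add: algebra_simps)
qed

text \<open>Applying \<open>step\<close> to the supremum itself gives M \<le> e + q M. The a priori
  bound \<open>W\<close> makes M finite, so that q M can be subtracted.\<close>

lemma absorb_bound:
  fixes f :: "'b \<Rightarrow> real"
  assumes W: "\<And>i. i \<in> A \<Longrightarrow> f i \<le> W"
    and q: "0 \<le> e" "0 \<le> q" "q < 1"
    and step: "\<And>M i. 0 \<le> M \<Longrightarrow> (\<And>i. i \<in> A \<Longrightarrow> f i \<le> M) \<Longrightarrow> i \<in> A \<Longrightarrow> f i \<le> e + q * M"
    and i: "i \<in> A"
  shows "f i \<le> e / (1 - q)"
proof -
  \<comment> \<open>The maximum with 0 meets the condition \<open>0 \<le> M\<close> of
    \<open>step\<close>.\<close>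
  define M where "M = max 0 (Sup (f ` A))"
  have "bdd_above (f ` A)"
    using W by (auto simp: bdd_above_def)
  then have le: "f j \<le> M" if "j \<in> A" for j
    using that cSUP_upper[of j A f] by (auto simp: M_def)
  have "0 \<le> M"
    by (simp add: M_def)
  then have "f j \<le> e + q * M" if "j \<in> A" for j
    using step le that by blast
  then have "Sup (f ` A) \<le> e + q * M"
    using i by (intro cSUP_least) auto
  then have "M \<le> e + q * M"
    using q \<open>0 \<le> M\<close> by (auto simp: M_def[symmetric]) (simp add: M_def)
  then have "M \<le> e / (1 - q)"
    using q by (simp add: field_simps)
  then show ?thesis
    using le[OF i] by simp
qed

lemma compact_simplex: "compact {(t, s). 0 \<le> s \<and> s \<le> t \<and> t \<le> (c::real)}"
proof -
  have "closed {p::real \<times> real. snd p \<le> fst p}"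
    by (intro closed_Collect_le continuous_intros)
  then have "compact (({0..c} \<times> {0..c}) \<inter> {p. snd p \<le> fst p})"
    by (intro compact_Int_closed compact_Times) auto
  moreover have "({0..c} \<times> {0..c}) \<inter> {p. snd p \<le> fst p} = {(t, s). 0 \<le> s \<and> s \<le> t \<and> t \<le> c}"
    by auto
  ultimately show ?thesis
    by simp
qed

lemma weighted_norm_bound:
  assumes w: "weighted_norm S \<alpha>0 lam \<gamma> u < \<infinity>" and lam: "0 < lam"
  obtains W where "\<And>a t. 0 \<le> t \<Longrightarrow> \<alpha>0 + lam * t < a \<Longrightarrow> a \<le> hi S \<Longrightarrow>
    (a - \<alpha>0 - lam * t) powr \<gamma> * nrm S a (u t) \<le> W"
proof -
  obtain k :: nat where k: "weighted_norm S \<alpha>0 lam \<gamma> u < ereal (real k)"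
    using w less_PInf_Ex_of_nat by auto
  show thesis
  proof (rule that)
    fix a t assume *: "0 \<le> t" "\<alpha>0 + lam * t < a" "a \<le> hi S"
    have "0 \<le> lam * t"
      using * lam by simp
    then have a: "a \<in> {\<alpha>0<..hi S}"
      using * by simp
    have t: "t \<in> {0..<(a - \<alpha>0) / lam}"
      using * lam by (simp add: field_simps)
    have "ereal ((a - \<alpha>0 - lam * t) powr \<gamma> * nrm S a (u t)) \<le> weighted_norm S \<alpha>0 lam \<gamma> u"
      unfolding weighted_norm_def
      by (rule SUP_upper2[OF a], rule SUP_upper[OF t])
    then have "ereal ((a - \<alpha>0 - lam * t) powr \<gamma> * nrm S a (u t)) < ereal (real k)"
      using k by (rule le_less_trans)
    then show "(a - \<alpha>0 - lam * t) powr \<gamma> * nrm S a (u t) \<le> real k"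
      by simp
  qed
qed

text \<open>The lower bound on \<lambda> enters in two consequences:
  \<open>hi S - \<alpha>0 < lam * T\<close> places all times of the solutions before T, and
  \<open>contraction\<close> says that the factor of the self-estimate is below 1.\<close>

locale scale_approximation =
  fixes S :: "'a::real_vector scale"
    and T \<beta> C1 C2 C3 \<alpha>0 \<gamma> lam :: real
    and r :: ereal
    and x :: 'a and xs :: "nat \<Rightarrow> 'a"
    and U :: "real \<Rightarrow> real \<Rightarrow> 'a scale_map" and Us :: "nat \<Rightarrow> real \<Rightarrow> real \<Rightarrow> 'a scale_map"
    and B :: "real \<Rightarrow> 'a scale_map" and Bs :: "nat \<Rightarrow> real \<Rightarrow> 'a scale_map"
    and u :: "real \<Rightarrow> 'a" and us :: "nat \<Rightarrow> real \<Rightarrow> 'a"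
  assumes scale: "banach_scale S"
    and r: "0 < r" and C1: "0 < C1" and C2: "0 < C2"
    and \<alpha>0: "lo S < \<alpha>0" "\<alpha>0 < hi S" and \<gamma>: "0 < \<gamma>"
    and lam: "0 < lam" "hi S - \<alpha>0 < lam * T"
    and contraction: "2 powr (2 + \<gamma>) * C1 * C2 < lam * \<gamma>"
    and x: "x \<in> spc S (lo S)" and xs: "\<And>n. xs n \<in> spc S (lo S)"
    and xs_lim: "limitin (scale_top S (lo S)) xs x sequentially"
    and U: "evolution_system S T \<beta> C1 U" and Us: "\<And>n. evolution_system S T \<beta> C1 (Us n)"
    and B: "nonlinearity S T \<beta> r C2 C3 x B" and Bs: "\<And>n. nonlinearity S T \<beta> r C2 C3 (xs n) (Bs n)"
    and U_lim: "\<And>\<alpha>' \<alpha> z K \<epsilon>. \<lbrakk>lo S \<le> \<alpha>'; \<alpha>' < \<alpha>; \<alpha> \<le> hi S; z \<in> spc S \<alpha>';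
        compact K; K \<subseteq> time_simplex T; \<epsilon> > 0\<rbrakk> \<Longrightarrow>
        \<forall>\<^sub>F n in sequentially. \<forall>(t, s)\<in>K.
          nrm S \<alpha> (Us n t s \<alpha>' \<alpha> z - U t s \<alpha>' \<alpha> z) < \<epsilon>"
    and B_lim: "\<And>\<alpha>' \<alpha> z K \<epsilon>. \<lbrakk>lo S \<le> \<alpha>'; \<alpha>' < \<alpha>; \<alpha> \<le> hi S; z \<in> scale_ball S \<alpha>' x r;
        compact K; K \<subseteq> {0..<T}; \<epsilon> > 0\<rbrakk> \<Longrightarrow>
        \<forall>\<^sub>F n in sequentially. z \<in> scale_ball S \<alpha>' (xs n) r \<longrightarrow>
          (\<forall>t\<in>K. nrm S \<alpha> (Bs n t \<alpha>' \<alpha> z - B t \<alpha>' \<alpha> z) < \<epsilon>)"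
    and u: "solution S \<alpha>0 lam r x U B u" "weighted_norm S \<alpha>0 lam \<gamma> u < \<infinity>"
    and us: "\<And>n. solution S \<alpha>0 lam r (xs n) (Us n) (Bs n) (us n)"
            "\<And>n. weighted_norm S \<alpha>0 lam \<gamma> (us n) < \<infinity>"
begin

section \<open>Times, indices and the domain of the solutions\<close>

lemma banach: "lo S \<le> a \<Longrightarrow> a \<le> hi S \<Longrightarrow> banach_space_on (spc S a) (nrm S a)"
  by (rule banach_space_on_spc[OF scale])

lemma x_in_spc: "lo S \<le> a \<Longrightarrow> a \<le> hi S \<Longrightarrow> x \<in> spc S a"
  using spc_mono[OF scale _ _ _ x] by simp

lemma xs_in_spc: "lo S \<le> a \<Longrightarrow> a \<le> hi S \<Longrightarrow> xs n \<in> spc S a"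
  using spc_mono[OF scale _ _ _ xs] by simp

text \<open>From here on t < T(a) is written without division as
  \<open>\<alpha>0 + lam * t < a\<close>. This one inequality then also supplies the position of the
  index in the scale.\<close>

lemma index_gt:
  assumes "0 \<le> s" "\<alpha>0 + lam * s < a"
  shows "\<alpha>0 < a" "lo S < a"
  using assms lam \<alpha>0 mult_nonneg_nonneg[of lam s] by linarith+

lemma time_lt:
  assumes "\<alpha>0 + lam * s \<le> hi S"
  shows "s < T"
proof -
  have "lam * s < lam * T"
    using assms lam(2) by linarith
  then show ?thesis
    using lam(1) by simp
qed

lemma solution_in_ball:
  assumes "solution S \<alpha>0 lam r y V D v" and s: "0 \<le> s" "\<alpha>0 + lam * s < a" "a \<le> hi S"
  shows "v s \<in> scale_ball S a y r"
proof -
  have "s \<in> {0..<(a - \<alpha>0) / lam}"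
    using s lam by (simp add: field_simps)
  then show ?thesis
    using assms index_gt[OF s(1,2)] unfolding solution_def by simp
qed

lemmas u_ball = solution_in_ball[OF u(1)]
lemmas us_ball = solution_in_ball[OF us(1)]

lemma u_in_spc: "0 \<le> s \<Longrightarrow> \<alpha>0 + lam * s < a \<Longrightarrow> a \<le> hi S \<Longrightarrow> u s \<in> spc S a"
  using u_ball by (auto simp: scale_ball_def)

lemma us_in_spc: "0 \<le> s \<Longrightarrow> \<alpha>0 + lam * s < a \<Longrightarrow> a \<le> hi S \<Longrightarrow> us n s \<in> spc S a"
  using us_ball by (auto simp: scale_ball_def)

lemma u_continuous:
  assumes s0: "0 \<le> s0" "\<alpha>0 + lam * s0 < a" "a \<le> hi S" and e: "0 < e"
  shows "\<exists>d>0. \<forall>s. 0 \<le> s \<longrightarrow> \<alpha>0 + lam * s < a \<longrightarrow> \<bar>s - s0\<bar> < d \<longrightarrow> nrm S a (u s - u s0) < e"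
proof -
  have a: "a \<in> {\<alpha>0<..hi S}"
    using index_gt[OF s0(1,2)] s0 by simp
  have dom: "s \<in> {0..<(a - \<alpha>0) / lam} \<longleftrightarrow> 0 \<le> s \<and> \<alpha>0 + lam * s < a" for s
    using lam by (simp add: field_simps)
  have "continuous_map (top_of_set {0..<(a - \<alpha>0) / lam}) (scale_top S a) u"
    using u(1) a unfolding solution_def by blast
  moreover have "banach_space_on (spc S a) (nrm S a)"
    using a \<alpha>0 by (intro banach) auto
  moreover have "s0 \<in> {0..<(a - \<alpha>0) / lam}"
    using dom s0 by blast
  ultimately obtain d where "d > 0" "\<forall>s\<in>{0..<(a - \<alpha>0) / lam}. dist s s0 < d \<longrightarrow> nrm S a (u s - u s0) < e"
    using continuous_map_norm_top e by blast
  then show ?thesis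
    using dom unfolding dist_real_def by blast
qed

text \<open>For \<open>\<kappa> < 1\<close> this contraction of \<open>u s\<close> towards \<open>x\<close> stays in the balls around \<open>xs n\<close> for
  large \<open>n\<close>, whereas \<open>u s\<close> itself may sit on the boundary of the ball around \<open>x\<close>.\<close>

definition pull :: "real \<Rightarrow> real \<Rightarrow> 'a" where
  "pull \<kappa> s = x + \<kappa> *\<^sub>R (u s - x)"

context
  fixes \<kappa> :: real
  assumes \<kappa>: "0 \<le> \<kappa>" "\<kappa> < 1"
begin

lemma pull_in_spc:
  assumes "0 \<le> s" "\<alpha>0 + lam * s < a" "a \<le> hi S"
  shows "pull \<kappa> s \<in> spc S a"
proof -
  have a: "lo S \<le> a"
    using index_gt assms by fastforce
  show ?thesis
    unfolding pull_def using u_in_spc assms x_in_spc[OF a] banach_subspace[OF banach[OF a]]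
    by (intro subspace_add subspace_scale subspace_diff) auto
qed

lemma pull_norm_le:
  assumes s: "0 \<le> s" "\<alpha>0 + lam * s < a" "a \<le> hi S"
  shows "ereal (nrm S a (pull \<kappa> s - x)) \<le> ereal \<kappa> * r"
proof -
  have a: "lo S \<le> a"
    using index_gt s by fastforce
  note Ba = banach[OF a s(3)]
  have "nrm S a (pull \<kappa> s - x) = \<kappa> * nrm S a (u s - x)"
    using norm_on_scaleR[OF Ba banach_diff[OF Ba u_in_spc[OF s] x_in_spc[OF a s(3)]]] \<kappa>
    by (simp add: pull_def)
  moreover have "ereal \<kappa> * ereal (nrm S a (u s - x)) \<le> ereal \<kappa> * r"
    using u_ball[OF s] \<kappa> by (intro ereal_mult_left_mono) (auto simp: scale_ball_def)
  ultimately show ?thesis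
    by simp
qed

lemma pull_ball:
  assumes s: "0 \<le> s" "\<alpha>0 + lam * s < a" "a \<le> hi S"
  shows "pull \<kappa> s \<in> scale_ball S a x r"
proof -
  have "ereal \<kappa> * r \<le> 1 * r"
    using \<kappa> r by (intro ereal_mult_right_mono) auto
  then show ?thesis
    using pull_in_spc[OF s] pull_norm_le[OF s] by (auto simp: scale_ball_def)
qed

text \<open>The radius splits as \<kappa> r for the distance of the pulled point from x and
  (1-\<kappa>) r for the distance of x from \<open>xs n\<close>. The latter is measured in the
  strongest norm, so one condition on n serves all s and a.\<close>

lemma pull_ball_xs:
  assumes s: "0 \<le> s" "\<alpha>0 + lam * s < a" "a \<le> hi S"
    and n: "ereal (nrm S (lo S) (xs n - x)) \<le> ereal (1 - \<kappa>) * r"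
  shows "pull \<kappa> s \<in> scale_ball S a (xs n) r"
proof -
  have a: "lo S \<le> a"
    using index_gt s by fastforce
  note Ba = banach[OF a s(3)] and Blo = banach[of "lo S"]
  have "nrm S a (pull \<kappa> s - xs n) \<le> nrm S a (pull \<kappa> s - x) + nrm S a (x - xs n)"
    using pull_in_spc[OF s] x_in_spc[OF a s(3)] xs_in_spc[OF a s(3)] by (intro norm_on_dist_triangle[OF Ba])
  moreover have "nrm S a (x - xs n) \<le> nrm S (lo S) (x - xs n)"
    using \<alpha>0 x xs a s by (intro nrm_mono[OF scale] banach_diff[OF Blo]) auto
  moreover have "nrm S (lo S) (x - xs n) = nrm S (lo S) (xs n - x)"
    using \<alpha>0 x xs by (intro norm_on_minus_commute[OF Blo]) auto
  ultimately have "ereal (nrm S a (pull \<kappa> s - xs n))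
      \<le> ereal (nrm S a (pull \<kappa> s - x)) + ereal (nrm S (lo S) (xs n - x))"
    by simp
  also have "\<dots> \<le> ereal \<kappa> * r + ereal (1 - \<kappa>) * r"
    using pull_norm_le[OF s] n by (rule add_mono)
  also have "\<dots> = (ereal \<kappa> + ereal (1 - \<kappa>)) * r"
    using \<kappa> by (intro ereal_left_distrib[symmetric]) auto
  finally show ?thesis
    using pull_in_spc[OF s] by (simp add: scale_ball_def)
qed

text \<open>This is where \<kappa> < 1 is essential: the right-hand side is positive for finite
  radius and infinite for infinite radius.\<close>

lemma eventually_xs_close:
  "\<forall>\<^sub>F n in sequentially. ereal (nrm S (lo S) (xs n - x)) \<le> ereal (1 - \<kappa>) * r"
proof (cases r)
  case (real q)
  then have "0 < (1 - \<kappa>) * q"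
    using r \<kappa> by simp
  then have "\<forall>\<^sub>F n in sequentially. nrm S (lo S) (xs n - x) < (1 - \<kappa>) * q"
    using \<alpha>0 by (intro limitin_norm_top[OF banach xs_lim]) auto
  then show ?thesis
    by eventually_elim (simp add: real)
qed (use r \<kappa> in auto)

end

section \<open>Uniform consistency away from the edge\<close>

context
  fixes \<eta> Tm :: real
  defines "Tm \<equiv> (hi S - \<alpha>0 - \<eta>) / lam"
  assumes \<eta>: "0 < \<eta>" "\<alpha>0 + \<eta> < hi S"
begin

lemma lam_Tm: "lam * Tm = hi S - \<alpha>0 - \<eta>"
  using lam by (simp add: Tm_def)

lemma Tm: "0 < Tm" "Tm < T"
proof -
  show "0 < Tm"
    using lam \<eta> by (simp add: Tm_def)
  show "Tm < T"
    using lam_Tm \<eta> by (intro time_lt) simp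
qed

text \<open>At \<open>Tm\<close> the line \<alpha>0 + \<eta> + \<lambda> s reaches the top of the
  scale. Hence \<open>{0..Tm}\<close> is compact and contains every time at which some index has a
  positive shifted gap.\<close>

lemma le_Tm: "s \<le> Tm \<longleftrightarrow> \<alpha>0 + \<eta> + lam * s \<le> hi S"
  using lam by (simp add: Tm_def field_simps)

text \<open>Moving the time this little moves the line \<alpha>0 + \<lambda> s by less than
  \<eta>/16. Levels attached to s0 at multiples of \<eta>/4 therefore keep their place between that
  line and its shift by \<eta>.\<close>

lemma near_index:
  assumes "\<bar>s - s0\<bar> < \<eta> / (16 * lam)"
  shows "lam * s < lam * s0 + \<eta> / 16" "lam * s0 < lam * s + \<eta> / 16"
proof -
  have "lam * \<bar>s - s0\<bar> < \<eta> / 16"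
    using assms lam by (simp add: field_simps)
  then have "\<bar>lam * s - lam * s0\<bar> < \<eta> / 16"
    using lam by (simp add: abs_mult right_diff_distrib[symmetric])
  then show "lam * s < lam * s0 + \<eta> / 16" "lam * s0 < lam * s + \<eta> / 16"
    by linarith+
qed

text \<open>The Lipschitz bound replaces u(s) by u(s0) at fixed time, and continuity in time is then
  applied at the fixed vector u(s0). The levels a and b belong to s0, so all nearby s are compared
  in one space; their distance \<eta>/4 gives the constant \<open>Q\<close>.\<close>

lemma continuous_B_u:
  assumes s0: "0 \<le> s0" "s0 \<le> Tm" and e: "0 < e"
    and a: "a = \<alpha>0 + lam * s0 + \<eta> / 4" "b = \<alpha>0 + lam * s0 + \<eta> / 2"
  shows "\<exists>d>0. \<forall>s\<in>{0..Tm}. \<bar>s - s0\<bar> < d \<longrightarrow> nrm S b (B s a b (u s) - B s0 a b (u s0)) < e"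
proof -
  have idx: "lo S \<le> a" "lo S \<le> b" "a < b" "a \<le> hi S" "b \<le> hi S" "\<alpha>0 + lam * s0 < a"
    using a \<eta> s0 le_Tm index_gt[OF s0(1), of a] by auto
  note Ba = banach[OF idx(1,4)] and Bb = banach[OF idx(2,5)]
  define Q where "Q = C2 / (\<eta> / 4) powr (1 - \<beta>)"
  have Q: "0 < Q"
    using C2 \<eta> by (simp add: Q_def)
  obtain d1 where d1: "d1 > 0"
      "\<And>s. 0 \<le> s \<Longrightarrow> \<alpha>0 + lam * s < a \<Longrightarrow> \<bar>s - s0\<bar> < d1 \<Longrightarrow> nrm S a (u s - u s0) < e / 2 / Q"
    using u_continuous[OF s0(1) idx(6,4), of "e / 2 / Q"] Q e by auto
  have u0: "u s0 \<in> scale_ball S a x r"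
    using idx s0 by (intro u_ball)
  have "continuous_map (top_of_set {0..<T}) (scale_top S b) (\<lambda>s. B s a b (u s0))"
    using nonlinearity_continuous_time[OF scale B idx(1,3,5) u0] .
  then obtain d2 where d2: "d2 > 0" "\<And>s. s \<in> {0..<T} \<Longrightarrow> dist s s0 < d2 \<Longrightarrow>
      nrm S b (B s a b (u s0) - B s0 a b (u s0)) < e / 2"
    using continuous_map_norm_top[OF Bb, of "{0..<T}" "\<lambda>s. B s a b (u s0)" s0 "e / 2"] s0 Tm e
    by auto
  show ?thesis
  proof (intro exI[of _ "min (\<eta> / (16 * lam)) (min d1 d2)"] conjI ballI impI)
    fix s assume s: "s \<in> {0..Tm}" "\<bar>s - s0\<bar> < min (\<eta> / (16 * lam)) (min d1 d2)"
    have s': "0 \<le> s" "s < T" "s0 < T" "\<alpha>0 + lam * s < a"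
      using s Tm s0 near_index[of s s0] a \<eta> by auto
    have us: "u s \<in> scale_ball S a x r"
      using s' idx by (intro u_ball)
    have "nrm S b (B s a b (u s) - B s a b (u s0)) \<le> Q * nrm S a (u s - u s0)"
      using nonlinearity_lipschitz[OF scale B s'(1,2) idx(1,3,5) us u0] a by (simp add: Q_def)
    also have "\<dots> < Q * (e / 2 / Q)"
      using d1(2)[OF s'(1,4)] s Q by (intro mult_strict_left_mono) auto
    also have "\<dots> = e / 2"
      using Q by simp
    finally have "nrm S b (B s a b (u s) - B s a b (u s0)) < e / 2" .
    moreover have "nrm S b (B s a b (u s0) - B s0 a b (u s0)) < e / 2"
      using d2(2)[of s] s s' by (auto simp: dist_real_def)
    moreover have "nrm S b (B s a b (u s) - B s0 a b (u s0))
        \<le> nrm S b (B s a b (u s) - B s a b (u s0)) + nrm S b (B s a b (u s0) - B s0 a b (u s0))"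
      using nonlinearity_in_spc[OF scale B _ _ idx(1,3,5)] s' s0 us u0
      by (intro norm_on_dist_triangle[OF Bb]) auto
    ultimately show "nrm S b (B s a b (u s) - B s0 a b (u s0)) < e"
      by linarith
  qed (use d1 d2 \<eta> lam in auto)
qed

lemma eventually_evolution_close:
  assumes e: "0 < e"
  shows "\<forall>\<^sub>F n in sequentially. \<forall>s\<in>{0..Tm}. \<forall>t d a b.
    s \<le> t \<longrightarrow> t \<le> Tm \<longrightarrow> \<alpha>0 + \<eta> + lam * s < d \<longrightarrow> d \<le> hi S \<longrightarrow>
    \<alpha>0 + lam * s < a \<longrightarrow> a < b \<longrightarrow> b < d \<longrightarrow>
    nrm S d (Us n t s b d (B s a b (u s)) - U t s b d (B s a b (u s))) < e"
proof (rule eventually_ball_compact)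
  fix s0 assume "s0 \<in> {0..Tm}"
  then have s0: "0 \<le> s0" "s0 \<le> Tm" by auto
  \<comment> \<open>Source, intermediate and target level, equally spaced inside the strip of height
    \<eta> above the line at s0.\<close>
  define a0 where "a0 = \<alpha>0 + lam * s0 + \<eta> / 4"
  define b0 where "b0 = \<alpha>0 + lam * s0 + \<eta> / 2"
  define d0 where "d0 = \<alpha>0 + lam * s0 + 3 * \<eta> / 4"
  have idx: "lo S \<le> a0" "a0 < b0" "b0 < d0" "d0 \<le> hi S" "\<alpha>0 + lam * s0 < a0"
    using \<eta> s0 le_Tm index_gt[OF s0(1), of a0] by (auto simp: a0_def b0_def d0_def)
  have Bb: "banach_space_on (spc S b0) (nrm S b0)" and Bd: "banach_space_on (spc S d0) (nrm S d0)"
    using idx by (auto intro!: banach)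
  define P where "P = C1 / (\<eta> / 4) powr \<beta>"
  have P: "0 < P"
    using C1 \<eta> by (simp add: P_def)
  obtain \<delta> where \<delta>: "\<delta> > 0"
      "\<And>s. s \<in> {0..Tm} \<Longrightarrow> \<bar>s - s0\<bar> < \<delta> \<Longrightarrow> nrm S b0 (B s a0 b0 (u s) - B s0 a0 b0 (u s0)) < e / 3 / P"
    using continuous_B_u[OF s0 _ a0_def b0_def, of "e / 3 / P"] e P by auto
  define w where "w s = B s a0 b0 (u s)" for s
  have w: "w s \<in> spc S b0" if "0 \<le> s" "s \<le> Tm" "\<alpha>0 + lam * s < a0" for s
    unfolding w_def using that idx Tm by (intro nonlinearity_in_spc[OF scale B] u_ball) auto
  define \<epsilon> where "\<epsilon> = min \<delta> (\<eta> / (16 * lam))"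
  have \<epsilon>: "\<epsilon> > 0"
    using \<delta> \<eta> lam by (simp add: \<epsilon>_def)
  have ev: "\<forall>\<^sub>F n in sequentially. \<forall>(t, s)\<in>{(t, s). 0 \<le> s \<and> s \<le> t \<and> t \<le> Tm}.
      nrm S d0 (Us n t s b0 d0 (w s0) - U t s b0 d0 (w s0)) < e / 3"
    using idx w[of s0] s0 e Tm by (intro U_lim compact_simplex) (auto simp: time_simplex_def)
  have "\<forall>\<^sub>F n in sequentially. \<forall>s\<in>ball s0 \<epsilon> \<inter> {0..Tm}. \<forall>t d a b.
    s \<le> t \<longrightarrow> t \<le> Tm \<longrightarrow> \<alpha>0 + \<eta> + lam * s < d \<longrightarrow> d \<le> hi S \<longrightarrow>
    \<alpha>0 + lam * s < a \<longrightarrow> a < b \<longrightarrow> b < d \<longrightarrow>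
    nrm S d (Us n t s b d (B s a b (u s)) - U t s b d (B s a b (u s))) < e"
    using ev
  proof (eventually_elim, intro ballI allI impI)
    fix n s t d a b
    assume lim: "\<forall>(t, s)\<in>{(t, s). 0 \<le> s \<and> s \<le> t \<and> t \<le> Tm}.
        nrm S d0 (Us n t s b0 d0 (w s0) - U t s b0 d0 (w s0)) < e / 3"
      and s: "s \<in> ball s0 \<epsilon> \<inter> {0..Tm}"
      and t: "s \<le> t" "t \<le> Tm" and d: "\<alpha>0 + \<eta> + lam * s < d" "d \<le> hi S"
      and ab: "\<alpha>0 + lam * s < a" "a < b" "b < d"
    have s': "0 \<le> s" "s \<le> Tm" "\<bar>s - s0\<bar> < \<delta>" "\<bar>s - s0\<bar> < \<eta> / (16 * lam)"
      using s by (auto simp: dist_real_def \<epsilon>_def abs_minus_commute)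
    note near = near_index[OF s'(4)]
    have sT: "s < T" "t < T" and sa0: "\<alpha>0 + lam * s < a0" and d0: "d0 \<le> d"
      using s' t Tm near \<eta> d by (auto simp: a0_def d0_def)
    \<comment> \<open>Index independence trades the arbitrary a, b, d for the levels of s0, so a
      single instance of C5 covers them all; since d0 \<le> d, the norm at d0 dominates the one at
      d.\<close>
    have same: "V t s b d (B s a b (u s)) = V t s b0 d0 (w s)" if V: "evolution_system S T \<beta> C1 V" for V
    proof -
      have b0: "B s a b (u s) = w s"
        unfolding w_def using idx ab s' sa0 d index_gt[OF s'(1) ab(1)]
        by (intro nonlinearity_indep[OF scale B s'(1) sT(1)] u_ball) auto
      have "w s \<in> spc S b"
        unfolding b0[symmetric] using ab d s' index_gt[OF s'(1) ab(1)]
        by (intro nonlinearity_in_spc[OF scale B s'(1) sT(1)] u_ball) auto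
      then show ?thesis
        unfolding b0 using w[OF s'(1,2) sa0] idx ab d index_gt[OF s'(1) ab(1)]
        by (intro evolution_indep[OF scale V s'(1) t(1) sT(2)]) auto
    qed
    have w_s: "w s \<in> spc S b0" and w_s0: "w s0 \<in> spc S b0"
      using w s' sa0 s0 idx by auto
    have b0: "lo S \<le> b0"
      using idx by simp
    have in_d0: "V t s b0 d0 y \<in> spc S d0" if "evolution_system S T \<beta> C1 V" "y \<in> spc S b0" for V y
      using evolution_in_spc[OF scale that(1) s'(1) t(1) sT(2) b0 idx(3,4) that(2)] .
    have small: "nrm S d0 (V t s b0 d0 (w s) - V t s b0 d0 (w s0)) < e / 3"
      if V: "evolution_system S T \<beta> C1 V" for V
    proof -
      have "nrm S d0 (V t s b0 d0 (w s) - V t s b0 d0 (w s0)) \<le> P * nrm S b0 (w s - w s0)"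
        using evolution_diff_bound[OF scale V s'(1) t(1) sT(2) b0 idx(3,4) w_s w_s0]
        by (simp add: P_def b0_def d0_def)
      also have "\<dots> < P * (e / 3 / P)"
        unfolding w_def using \<delta>(2)[of s] s' P by (intro mult_strict_left_mono) auto
      finally show ?thesis
        using P by simp
    qed
    have "nrm S d (Us n t s b d (B s a b (u s)) - U t s b d (B s a b (u s)))
        \<le> nrm S d0 (Us n t s b0 d0 (w s) - U t s b0 d0 (w s))"
      unfolding same[OF Us] same[OF U] using d d0 idx Us U w_s
      by (intro nrm_mono[OF scale] banach_diff[OF Bd] in_d0) auto
    also have "\<dots> \<le> nrm S d0 (Us n t s b0 d0 (w s) - Us n t s b0 d0 (w s0))
        + nrm S d0 (Us n t s b0 d0 (w s0) - U t s b0 d0 (w s))"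
      using Us U w_s w_s0 by (intro norm_on_dist_triangle[OF Bd] in_d0)
    also have "nrm S d0 (Us n t s b0 d0 (w s0) - U t s b0 d0 (w s))
        \<le> nrm S d0 (Us n t s b0 d0 (w s0) - U t s b0 d0 (w s0))
        + nrm S d0 (U t s b0 d0 (w s0) - U t s b0 d0 (w s))"
      using Us U w_s w_s0 by (intro norm_on_dist_triangle[OF Bd] in_d0)
    also have "nrm S d0 (U t s b0 d0 (w s0) - U t s b0 d0 (w s))
        = nrm S d0 (U t s b0 d0 (w s) - U t s b0 d0 (w s0))"
      using U w_s w_s0 by (intro norm_on_minus_commute[OF Bd] in_d0)
    finally show "nrm S d (Us n t s b d (B s a b (u s)) - U t s b d (B s a b (u s))) < e"
      using small[OF U] small[OF Us[of n]] lim s' t by fastforce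
  qed
  then show "\<exists>W. open W \<and> s0 \<in> W \<and> (\<forall>\<^sub>F n in sequentially. \<forall>s\<in>W \<inter> {0..Tm}. \<forall>t d a b.
    s \<le> t \<longrightarrow> t \<le> Tm \<longrightarrow> \<alpha>0 + \<eta> + lam * s < d \<longrightarrow> d \<le> hi S \<longrightarrow>
    \<alpha>0 + lam * s < a \<longrightarrow> a < b \<longrightarrow> b < d \<longrightarrow>
    nrm S d (Us n t s b d (B s a b (u s)) - U t s b d (B s a b (u s))) < e)"
    using \<epsilon> by (intro exI[of _ "ball s0 \<epsilon>"]) auto
qed simp

text \<open>Freezing at s0 works again, now for the argument of the nonlinearity. That argument is
  the pulled point, since the convergence of B_n is only given where the argument lies in the ball
  around \<open>xs n\<close>. Pulling does not increase distances, so continuity of u carries over,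
  and the evolution U_n common to both terms costs the factor \<open>P\<close>.\<close>

lemma eventually_nonlinearity_close:
  assumes e: "0 < e" and \<kappa>: "0 \<le> \<kappa>" "\<kappa> < 1"
  shows "\<forall>\<^sub>F n in sequentially. \<forall>s\<in>{0..Tm}. \<forall>t d a b.
    s \<le> t \<longrightarrow> t \<le> Tm \<longrightarrow> \<alpha>0 + \<eta> + lam * s < d \<longrightarrow> d \<le> hi S \<longrightarrow>
    \<alpha>0 + lam * s < a \<longrightarrow> a < b \<longrightarrow> b < d \<longrightarrow>
    nrm S d (Us n t s b d (Bs n s a b (pull \<kappa> s)) - Us n t s b d (B s a b (pull \<kappa> s))) < e"
proof (rule eventually_ball_compact)
  fix s0 assume "s0 \<in> {0..Tm}"
  then have s0: "0 \<le> s0" "s0 \<le> Tm" by auto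
  define a0 where "a0 = \<alpha>0 + lam * s0 + \<eta> / 4"
  define b0 where "b0 = \<alpha>0 + lam * s0 + \<eta> / 2"
  define d0 where "d0 = \<alpha>0 + lam * s0 + 3 * \<eta> / 4"
  have idx: "lo S \<le> a0" "a0 < b0" "b0 < d0" "d0 \<le> hi S" "\<alpha>0 + lam * s0 < a0" "lo S \<le> b0" "b0 \<le> hi S"
    using \<eta> s0 le_Tm index_gt[OF s0(1), of a0] by (auto simp: a0_def b0_def d0_def)
  have Ba: "banach_space_on (spc S a0) (nrm S a0)" and Bb: "banach_space_on (spc S b0) (nrm S b0)"
    and Bd: "banach_space_on (spc S d0) (nrm S d0)"
    using idx by (auto intro!: banach)
  define P where "P = C1 / (\<eta> / 4) powr \<beta>"
  define Q where "Q = C2 / (\<eta> / 4) powr (1 - \<beta>)"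
  have P: "0 < P" and Q: "0 < Q"
    using C1 C2 \<eta> by (simp_all add: P_def Q_def)
  have a0_hi: "a0 \<le> hi S"
    using idx by simp
  obtain \<delta> where \<delta>: "\<delta> > 0" "\<And>s. 0 \<le> s \<Longrightarrow> \<alpha>0 + lam * s < a0 \<Longrightarrow> \<bar>s - s0\<bar> < \<delta> \<Longrightarrow>
      nrm S a0 (u s - u s0) < e / 3 / P / Q"
    using u_continuous[OF s0(1) idx(5) a0_hi, of "e / 3 / P / Q"] e P Q by auto
  define \<epsilon> where "\<epsilon> = min \<delta> (\<eta> / (16 * lam))"
  have \<epsilon>: "\<epsilon> > 0"
    using \<delta> \<eta> lam by (simp add: \<epsilon>_def)
  let ?z = "pull \<kappa>"
  have z0: "?z s0 \<in> scale_ball S a0 x r"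
    by (rule pull_ball[OF \<kappa> s0(1) idx(5) a0_hi])
  have "\<forall>\<^sub>F n in sequentially. ?z s0 \<in> scale_ball S a0 (xs n) r \<longrightarrow>
      (\<forall>s\<in>{0..Tm}. nrm S b0 (Bs n s a0 b0 (?z s0) - B s a0 b0 (?z s0)) < e / 3 / P)"
    using idx z0 Tm e P by (intro B_lim) auto
  with eventually_xs_close[OF \<kappa>]
  have "\<forall>\<^sub>F n in sequentially. \<forall>s\<in>ball s0 \<epsilon> \<inter> {0..Tm}. \<forall>t d a b.
    s \<le> t \<longrightarrow> t \<le> Tm \<longrightarrow> \<alpha>0 + \<eta> + lam * s < d \<longrightarrow> d \<le> hi S \<longrightarrow>
    \<alpha>0 + lam * s < a \<longrightarrow> a < b \<longrightarrow> b < d \<longrightarrow>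
    nrm S d (Us n t s b d (Bs n s a b (?z s)) - Us n t s b d (B s a b (?z s))) < e"
  proof (eventually_elim, intro ballI allI impI)
    fix n s t d a b
    assume xn: "ereal (nrm S (lo S) (xs n - x)) \<le> ereal (1 - \<kappa>) * r"
      and "?z s0 \<in> scale_ball S a0 (xs n) r \<longrightarrow>
        (\<forall>s\<in>{0..Tm}. nrm S b0 (Bs n s a0 b0 (?z s0) - B s a0 b0 (?z s0)) < e / 3 / P)"
      and s: "s \<in> ball s0 \<epsilon> \<inter> {0..Tm}"
      and t: "s \<le> t" "t \<le> Tm" and d: "\<alpha>0 + \<eta> + lam * s < d" "d \<le> hi S"
      and ab: "\<alpha>0 + lam * s < a" "a < b" "b < d"
    note z_xs = pull_ball_xs[OF \<kappa> _ _ _ xn] and z_x = pull_ball[OF \<kappa>]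
    \<comment> \<open>The convergence is conditional on the domain of B_n; closeness of
      \<open>xs n\<close> to x discharges the condition.\<close>
    have lim: "nrm S b0 (Bs n s a0 b0 (?z s0) - B s a0 b0 (?z s0)) < e / 3 / P"
      using \<open>_ \<longrightarrow> _\<close> z_xs[OF s0(1) idx(5) a0_hi] s by blast
    have s': "0 \<le> s" "s \<le> Tm" "\<bar>s - s0\<bar> < \<delta>" "\<bar>s - s0\<bar> < \<eta> / (16 * lam)"
      using s by (auto simp: dist_real_def \<epsilon>_def abs_minus_commute)
    note near = near_index[OF s'(4)]
    have sT: "s < T" "t < T" and sa0: "\<alpha>0 + lam * s < a0" and d0: "d0 \<le> d"
      using s' t Tm near \<eta> d by (auto simp: a0_def d0_def)
    have a: "lo S \<le> a" "a \<le> hi S" "b \<le> hi S"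
      using index_gt[OF s'(1) ab(1)] ab d by auto
    have same: "Us n t s b d (D s a b (?z s)) = Us n t s b0 d0 (D s a0 b0 (?z s))"
        and in_b0: "D s a0 b0 (?z s) \<in> spc S b0"
      if D: "nonlinearity S T \<beta> r C2 C3 c D"
        and c: "?z s \<in> scale_ball S a c r" "?z s \<in> scale_ball S a0 c r" for c D
    proof -
      have b0: "D s a b (?z s) = D s a0 b0 (?z s)"
        using idx ab a d c by (intro nonlinearity_indep[OF scale D s'(1) sT(1)]) auto
      show *: "D s a0 b0 (?z s) \<in> spc S b0"
        using idx c by (intro nonlinearity_in_spc[OF scale D s'(1) sT(1)]) auto
      have "D s a0 b0 (?z s) \<in> spc S b"
        unfolding b0[symmetric] using ab a d c
        by (intro nonlinearity_in_spc[OF scale D s'(1) sT(1)]) auto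
      then show "Us n t s b d (D s a b (?z s)) = Us n t s b0 d0 (D s a0 b0 (?z s))"
        unfolding b0 using * idx ab a d
        by (intro evolution_indep[OF scale Us s'(1) t(1) sT(2)]) auto
    qed
    have zs: "?z s \<in> scale_ball S a x r" "?z s \<in> scale_ball S a0 x r"
        "?z s \<in> scale_ball S a (xs n) r" "?z s \<in> scale_ball S a0 (xs n) r"
      using z_x z_xs s' ab a sa0 a0_hi by auto
    have zs0: "?z s0 \<in> scale_ball S a0 x r" "?z s0 \<in> scale_ball S a0 (xs n) r"
      using z_x z_xs s0 idx a0_hi by auto
    have u_spc: "u s \<in> spc S a0" "u s0 \<in> spc S a0"
      using u_in_spc s' s0 sa0 idx a0_hi by auto
    have lip: "nrm S b0 (D s a0 b0 (?z s) - D s a0 b0 (?z s0)) < e / 3 / P"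
      if D: "nonlinearity S T \<beta> r C2 C3 c D"
        and c: "?z s \<in> scale_ball S a0 c r" "?z s0 \<in> scale_ball S a0 c r" for c D
    proof -
      have "nrm S b0 (D s a0 b0 (?z s) - D s a0 b0 (?z s0)) \<le> Q * nrm S a0 (?z s - ?z s0)"
        using nonlinearity_lipschitz[OF scale D s'(1) sT(1) idx(1,2,7) c]
        by (simp add: Q_def a0_def b0_def)
      also have "?z s - ?z s0 = \<kappa> *\<^sub>R (u s - u s0)"
        by (simp add: pull_def scaleR_diff_right)
      also have "nrm S a0 \<dots> = \<kappa> * nrm S a0 (u s - u s0)"
        using norm_on_scaleR[OF Ba banach_diff[OF Ba u_spc]] \<kappa> by simp
      also have "\<dots> \<le> 1 * nrm S a0 (u s - u s0)"
        using \<kappa> norm_on_nonneg[OF Ba banach_diff[OF Ba u_spc]] by (intro mult_right_mono) auto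
      also have "Q * (1 * nrm S a0 (u s - u s0)) < Q * (e / 3 / P / Q)"
        using \<delta>(2)[OF s'(1) sa0 s'(3)] Q by (intro mult_strict_left_mono) auto
      also have "\<dots> = e / 3 / P"
        using Q by simp
      finally show ?thesis
        using Q by simp
    qed
    have D_in: "Bs n s a0 b0 y \<in> spc S b0" "B s a0 b0 y \<in> spc S b0"
      if "y = ?z s \<or> y = ?z s0" for y
      using that zs zs0 idx
      by (auto intro!: nonlinearity_in_spc[OF scale B s'(1) sT(1)]
          nonlinearity_in_spc[OF scale Bs s'(1) sT(1)])
    have "nrm S b0 (Bs n s a0 b0 (?z s) - B s a0 b0 (?z s))
        \<le> nrm S b0 (Bs n s a0 b0 (?z s) - Bs n s a0 b0 (?z s0))
          + nrm S b0 (Bs n s a0 b0 (?z s0) - B s a0 b0 (?z s))"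
      using D_in by (intro norm_on_dist_triangle[OF Bb]) auto
    also have "nrm S b0 (Bs n s a0 b0 (?z s0) - B s a0 b0 (?z s))
        \<le> nrm S b0 (Bs n s a0 b0 (?z s0) - B s a0 b0 (?z s0))
          + nrm S b0 (B s a0 b0 (?z s0) - B s a0 b0 (?z s))"
      using D_in by (intro norm_on_dist_triangle[OF Bb]) auto
    also have "nrm S b0 (B s a0 b0 (?z s0) - B s a0 b0 (?z s))
        = nrm S b0 (B s a0 b0 (?z s) - B s a0 b0 (?z s0))"
      using D_in by (intro norm_on_minus_commute[OF Bb]) auto
    finally have Bclose: "nrm S b0 (Bs n s a0 b0 (?z s) - B s a0 b0 (?z s)) < e / P"
      using lip[OF B zs(2) zs0(1)] lip[OF Bs zs(4) zs0(2)] lim by linarith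
    have "nrm S d (Us n t s b d (Bs n s a b (?z s)) - Us n t s b d (B s a b (?z s)))
        \<le> nrm S d0 (Us n t s b0 d0 (Bs n s a0 b0 (?z s)) - Us n t s b0 d0 (B s a0 b0 (?z s)))"
      unfolding same[OF Bs zs(3,4)] same[OF B zs(1,2)] using d d0 idx D_in
      by (intro nrm_mono[OF scale] banach_diff[OF Bd] evolution_in_spc[OF scale Us s'(1) t(1) sT(2)]) auto
    also have "\<dots> \<le> P * nrm S b0 (Bs n s a0 b0 (?z s) - B s a0 b0 (?z s))"
      using evolution_diff_bound[OF scale Us s'(1) t(1) sT(2) idx(6,3,4) D_in]
      by (simp add: P_def b0_def d0_def)
    also have "\<dots> < P * (e / P)"
      using Bclose P by (intro mult_strict_left_mono) auto
    finally show "nrm S d (Us n t s b d (Bs n s a b (?z s)) - Us n t s b d (B s a b (?z s))) < e"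
      using P by simp
  qed
  then show "\<exists>W. open W \<and> s0 \<in> W \<and> (\<forall>\<^sub>F n in sequentially. \<forall>s\<in>W \<inter> {0..Tm}. \<forall>t d a b.
    s \<le> t \<longrightarrow> t \<le> Tm \<longrightarrow> \<alpha>0 + \<eta> + lam * s < d \<longrightarrow> d \<le> hi S \<longrightarrow>
    \<alpha>0 + lam * s < a \<longrightarrow> a < b \<longrightarrow> b < d \<longrightarrow>
    nrm S d (Us n t s b d (Bs n s a b (?z s)) - Us n t s b d (B s a b (?z s))) < e)"
    using \<epsilon> by (intro exI[of _ "ball s0 \<epsilon>"]) auto
qed simp

text \<open>The uniform bound on U_n handles the change of initial value, and C5 at the fixed vector
  x handles the change of evolution. The norm at \<alpha>0 dominates those at all later
  indices.\<close>

lemma eventually_initial_close: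
  assumes e: "0 < e"
  shows "\<forall>\<^sub>F n in sequentially. \<forall>t\<in>{0..Tm}.
    nrm S \<alpha>0 (Us n t 0 (lo S) \<alpha>0 (xs n) - U t 0 (lo S) \<alpha>0 x) < e"
proof -
  have \<alpha>0': "lo S \<le> lo S" "lo S < \<alpha>0" "\<alpha>0 \<le> hi S"
    using \<alpha>0 by auto
  have B0: "banach_space_on (spc S \<alpha>0) (nrm S \<alpha>0)"
    using \<alpha>0 by (intro banach) auto
  define P where "P = C1 / (\<alpha>0 - lo S) powr \<beta>"
  have P: "0 < P"
    using C1 \<alpha>0 by (simp add: P_def)
  have "\<forall>\<^sub>F n in sequentially. nrm S (lo S) (xs n - x) < e / 2 / P"
    using \<alpha>0 e P by (intro limitin_norm_top[OF banach xs_lim]) auto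
  moreover have "\<forall>\<^sub>F n in sequentially. \<forall>(t, s)\<in>{(t, s). 0 \<le> s \<and> s \<le> t \<and> t \<le> Tm}.
      nrm S \<alpha>0 (Us n t s (lo S) \<alpha>0 x - U t s (lo S) \<alpha>0 x) < e / 2"
    using \<alpha>0' x Tm e by (intro U_lim compact_simplex) (auto simp: time_simplex_def)
  ultimately show ?thesis
  proof (eventually_elim, intro ballI)
    fix n t
    assume n: "nrm S (lo S) (xs n - x) < e / 2 / P"
      "\<forall>(t, s)\<in>{(t, s). 0 \<le> s \<and> s \<le> t \<and> t \<le> Tm}.
        nrm S \<alpha>0 (Us n t s (lo S) \<alpha>0 x - U t s (lo S) \<alpha>0 x) < e / 2"
      and t: "t \<in> {0..Tm}"
    have t': "0 \<le> (0::real)" "0 \<le> t" "t < T"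
      using t Tm by auto
    have "nrm S \<alpha>0 (Us n t 0 (lo S) \<alpha>0 (xs n) - Us n t 0 (lo S) \<alpha>0 x)
        \<le> P * nrm S (lo S) (xs n - x)"
      using evolution_diff_bound[OF scale Us t' \<alpha>0' xs x] by (simp add: P_def)
    also have "\<dots> < P * (e / 2 / P)"
      using n P by (intro mult_strict_left_mono) auto
    also have "\<dots> = e / 2"
      using P by simp
    finally have "nrm S \<alpha>0 (Us n t 0 (lo S) \<alpha>0 (xs n) - Us n t 0 (lo S) \<alpha>0 x) < e / 2" .
    moreover have "nrm S \<alpha>0 (Us n t 0 (lo S) \<alpha>0 x - U t 0 (lo S) \<alpha>0 x) < e / 2"
      using n(2) t by auto
    moreover have "nrm S \<alpha>0 (Us n t 0 (lo S) \<alpha>0 (xs n) - U t 0 (lo S) \<alpha>0 x)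
        \<le> nrm S \<alpha>0 (Us n t 0 (lo S) \<alpha>0 (xs n) - Us n t 0 (lo S) \<alpha>0 x)
          + nrm S \<alpha>0 (Us n t 0 (lo S) \<alpha>0 x - U t 0 (lo S) \<alpha>0 x)"
      using x xs evolution_in_spc[OF scale U t' \<alpha>0'] evolution_in_spc[OF scale Us t' \<alpha>0']
      by (intro norm_on_dist_triangle[OF B0]) auto
    ultimately show "nrm S \<alpha>0 (Us n t 0 (lo S) \<alpha>0 (xs n) - U t 0 (lo S) \<alpha>0 x) < e"
      by linarith
  qed
qed

section \<open>The integral inequality for the weighted distance\<close>

lemma u_bounded:
  obtains K where "0 \<le> K"
    "\<And>s a. 0 \<le> s \<Longrightarrow> \<alpha>0 + \<eta> + lam * s \<le> a \<Longrightarrow> a \<le> hi S \<Longrightarrow> nrm S a (u s - x) \<le> K"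
proof -
  obtain W where W: "\<And>a t. 0 \<le> t \<Longrightarrow> \<alpha>0 + lam * t < a \<Longrightarrow> a \<le> hi S \<Longrightarrow>
      (a - \<alpha>0 - lam * t) powr \<gamma> * nrm S a (u t) \<le> W"
    using weighted_norm_bound[OF u(2) lam(1)] by blast
  define K where "K = W / \<eta> powr \<gamma> + nrm S (lo S) x"
  have K: "nrm S a (u s - x) \<le> K" if s: "0 \<le> s" and a: "\<alpha>0 + \<eta> + lam * s \<le> a" "a \<le> hi S" for s a
  proof -
    have b: "lo S \<le> \<alpha>0 + \<eta> + lam * s" "\<alpha>0 + \<eta> + lam * s \<le> hi S" "\<alpha>0 + lam * s < \<alpha>0 + \<eta> + lam * s"
      using index_gt[OF s, of "\<alpha>0 + \<eta> + lam * s"] \<eta> a by auto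
    \<comment> \<open>On the shifted line the unshifted weight is exactly \<eta>^\<gamma>; larger
      indices have smaller norms.\<close>
    have "\<eta> powr \<gamma> * nrm S (\<alpha>0 + \<eta> + lam * s) (u s) \<le> W"
      using W[OF s b(3,2)] by simp
    then have "nrm S (\<alpha>0 + \<eta> + lam * s) (u s) \<le> W / \<eta> powr \<gamma>"
      using \<eta> by (simp add: field_simps)
    moreover have "nrm S a (u s) \<le> nrm S (\<alpha>0 + \<eta> + lam * s) (u s)"
      using b a u_in_spc[OF s b(3,2)] by (intro nrm_mono[OF scale]) auto
    moreover have "nrm S a x \<le> nrm S (lo S) x"
      using b a x by (intro nrm_mono[OF scale]) auto
    moreover have "nrm S a (u s - x) \<le> nrm S a (u s) + nrm S a x"
      using b a s \<eta> by (intro norm_on_triangle_minus[OF banach] u_in_spc x_in_spc) auto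
    ultimately show ?thesis
      by (simp add: K_def)
  qed
  \<comment> \<open>Nonnegativity of \<open>K\<close> is read off from one norm that it
    bounds.\<close>
  have "nrm S (hi S) (u 0 - x) \<le> K"
    using \<eta> by (intro K) auto
  moreover have "0 \<le> nrm S (hi S) (u 0 - x)"
    using \<alpha>0 by (intro norm_on_nonneg[OF banach] banach_diff[OF banach] u_in_spc x_in_spc) auto
  ultimately have "0 \<le> K"
    by simp
  with K show thesis
    by (rule that[rotated])
qed

text \<open>With z the pulled point, the chain is U_n B_n(u_n), U_n B_n(z), U_n B(z), U_n B(u), U
  B(u). Each argument lies in the ball of the nonlinearity applied to it. The first and third
  differences are Lipschitz estimates, the other two are the consistency errors. Choosing \<kappa> =
  1 - e makes the displacement u(s) - z = e (u(s) - x), of size at most e K.\<close>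

lemma integrand_close:
  assumes e: "0 < e" "e \<le> 1"
    and K: "0 \<le> K" "\<And>s a. 0 \<le> s \<Longrightarrow> \<alpha>0 + \<eta> + lam * s \<le> a \<Longrightarrow> a \<le> hi S \<Longrightarrow> nrm S a (u s - x) \<le> K"
    and evol: "\<forall>s\<in>{0..Tm}. \<forall>t d a b.
      s \<le> t \<longrightarrow> t \<le> Tm \<longrightarrow> \<alpha>0 + \<eta> + lam * s < d \<longrightarrow> d \<le> hi S \<longrightarrow>
      \<alpha>0 + lam * s < a \<longrightarrow> a < b \<longrightarrow> b < d \<longrightarrow>
      nrm S d (Us n t s b d (B s a b (u s)) - U t s b d (B s a b (u s))) < e"
    and nonlin: "\<forall>s\<in>{0..Tm}. \<forall>t d a b.
      s \<le> t \<longrightarrow> t \<le> Tm \<longrightarrow> \<alpha>0 + \<eta> + lam * s < d \<longrightarrow> d \<le> hi S \<longrightarrow>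
      \<alpha>0 + lam * s < a \<longrightarrow> a < b \<longrightarrow> b < d \<longrightarrow>
      nrm S d (Us n t s b d (Bs n s a b (pull (1 - e) s)) - Us n t s b d (B s a b (pull (1 - e) s))) < e"
    and xn: "ereal (nrm S (lo S) (xs n - x)) \<le> ereal (1 - (1 - e)) * r"
    and M: "\<And>d t. 0 \<le> t \<Longrightarrow> \<alpha>0 + \<eta> + lam * t < d \<Longrightarrow> d \<le> hi S \<Longrightarrow>
      (d - \<alpha>0 - \<eta> - lam * t) powr \<gamma> * nrm S d (us n t - u t) \<le> M"
    and st: "0 \<le> s" "s \<le> t" and d: "\<alpha>0 + \<eta> + lam * t < d" "d \<le> hi S"
    and h: "h = (d - \<alpha>0 - \<eta> - lam * s) / 4"
  shows "nrm S d (Us n t s (d - h) d (Bs n s (d - 2 * h) (d - h) (us n s))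
      - U t s (d - h) d (B s (d - 2 * h) (d - h) (u s)))
    \<le> C1 * C2 / h * (M * (2 * h) powr - \<gamma> + e * K) + e + C1 * C2 / h * (e * K) + e"
proof -
  let ?a = "d - 2 * h" and ?b = "d - h" and ?z = "pull (1 - e) s"
  have \<kappa>: "0 \<le> 1 - e" "1 - e < 1"
    using e by auto
  have "lam * s \<le> lam * t"
    using st lam by simp
  then have h0: "0 < h" and ds: "\<alpha>0 + \<eta> + lam * s < d"
    using d by (auto simp: h)
  have a: "\<alpha>0 + \<eta> + lam * s < ?a" "?a \<le> hi S" "?a < ?b" "?b < d"
    using ds d h0 unfolding h by (simp_all add: field_simps)
  have as: "\<alpha>0 + lam * s < ?a"
    using a \<eta> by simp
  have lo: "lo S \<le> ?a" "lo S \<le> ?b" "lo S \<le> d"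
    using index_gt[OF st(1) as] h0 by auto
  have t: "t \<le> Tm"
    using d le_Tm by auto
  then have t: "t \<le> Tm" "s \<le> Tm" "t < T" "s < T"
    using st Tm by auto
  note Ba = banach[OF lo(1) a(2)] and Bd = banach[OF lo(3) d(2)]
  have balls: "us n s \<in> scale_ball S ?a (xs n) r" "u s \<in> scale_ball S ?a x r"
      "?z \<in> scale_ball S ?a x r" "?z \<in> scale_ball S ?a (xs n) r"
    using us_ball[OF st(1) as a(2)] u_ball[OF st(1) as a(2)] pull_ball[OF \<kappa> st(1) as a(2)]
      pull_ball_xs[OF \<kappa> st(1) as a(2) xn] by auto
  have spcs: "us n s \<in> spc S ?a" "u s \<in> spc S ?a" "?z \<in> spc S ?a" "x \<in> spc S ?a"
    using balls x_in_spc lo a by (auto simp: scale_ball_def)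
  have "u s - ?z = e *\<^sub>R (u s - x)"
    by (simp add: pull_def algebra_simps)
  then have "nrm S ?a (u s - ?z) = e * nrm S ?a (u s - x)"
    using norm_on_scaleR[OF Ba banach_diff[OF Ba spcs(2,4)]] e by simp
  also have "\<dots> \<le> e * K"
    using K(2)[OF st(1), of ?a] a e by (intro mult_left_mono) auto
  finally have uz: "nrm S ?a (u s - ?z) \<le> e * K" .
  \<comment> \<open>Half of the gap 4 h survives at the source index, and the weighted bound
    \<open>M\<close> is evaluated there.\<close>
  have gap: "?a - \<alpha>0 - \<eta> - lam * s = 2 * h"
    by (simp add: h field_simps)
  have "(2 * h) powr \<gamma> * nrm S ?a (us n s - u s) \<le> M"
    using M[OF st(1) a(1,2)] unfolding gap .
  then have "nrm S ?a (us n s - u s) \<le> M * (2 * h) powr - \<gamma>"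
    using h0 by (simp add: powr_minus field_simps)
  moreover have "nrm S ?a (us n s - ?z) \<le> nrm S ?a (us n s - u s) + nrm S ?a (u s - ?z)"
    using spcs by (intro norm_on_dist_triangle[OF Ba])
  ultimately have usz: "nrm S ?a (us n s - ?z) \<le> M * (2 * h) powr - \<gamma> + e * K"
    using uz by linarith
  define G where "G V D y = V t s ?b d (D s ?a ?b y)" for V :: "real \<Rightarrow> real \<Rightarrow> 'a scale_map"
    and D :: "real \<Rightarrow> 'a scale_map" and y
  have G: "G V D y \<in> spc S d" if "evolution_system S T \<beta> C1 V" "nonlinearity S T \<beta> r C2 C3 c D"
      "y \<in> scale_ball S ?a c r" for V D y c
    unfolding G_def using that lo a d t st
    by (intro evolution_in_spc[OF scale that(1)] nonlinearity_in_spc[OF scale that(2)]) auto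
  have Gs: "G (Us n) (Bs n) (us n s) \<in> spc S d" "G (Us n) (Bs n) ?z \<in> spc S d"
      "G (Us n) B ?z \<in> spc S d" "G (Us n) B (u s) \<in> spc S d" "G U B (u s) \<in> spc S d"
    using G[OF Us Bs] G[OF Us B] G[OF U B] balls by auto
  have C12: "0 \<le> C1 * C2 / h"
    using C1 C2 h0 by simp
  have "nrm S d (G (Us n) (Bs n) (us n s) - G (Us n) (Bs n) ?z) \<le> C1 * C2 / h * nrm S ?a (us n s - ?z)"
    unfolding G_def using C1 h0 lo d st t balls
    by (intro evolution_nonlinearity_lipschitz[OF scale Bs st(1) _ Us]) auto
  also have "\<dots> \<le> C1 * C2 / h * (M * (2 * h) powr - \<gamma> + e * K)"
    using usz C12 by (rule mult_left_mono)
  finally have 1: "nrm S d (G (Us n) (Bs n) (us n s) - G (Us n) (Bs n) ?z)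
      \<le> C1 * C2 / h * (M * (2 * h) powr - \<gamma> + e * K)" .
  have 2: "nrm S d (G (Us n) (Bs n) ?z - G (Us n) B ?z) < e"
    unfolding G_def using nonlin st t ds d a as by auto
  have "nrm S d (G (Us n) B ?z - G (Us n) B (u s)) \<le> C1 * C2 / h * nrm S ?a (?z - u s)"
    unfolding G_def using C1 h0 lo d st t balls
    by (intro evolution_nonlinearity_lipschitz[OF scale B st(1) _ Us]) auto
  also have "nrm S ?a (?z - u s) = nrm S ?a (u s - ?z)"
    using spcs by (intro norm_on_minus_commute[OF Ba])
  also have "C1 * C2 / h * nrm S ?a (u s - ?z) \<le> C1 * C2 / h * (e * K)"
    using uz C12 by (rule mult_left_mono)
  finally have 3: "nrm S d (G (Us n) B ?z - G (Us n) B (u s)) \<le> C1 * C2 / h * (e * K)" .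
  have 4: "nrm S d (G (Us n) B (u s) - G U B (u s)) < e"
    unfolding G_def using evol st t ds d a as by auto
  have "nrm S d (G (Us n) (Bs n) (us n s) - G U B (u s))
      \<le> nrm S d (G (Us n) (Bs n) (us n s) - G (Us n) (Bs n) ?z)
        + (nrm S d (G (Us n) (Bs n) ?z - G (Us n) B ?z)
        + (nrm S d (G (Us n) B ?z - G (Us n) B (u s)) + nrm S d (G (Us n) B (u s) - G U B (u s))))"
    using norm_on_dist_triangle[OF Bd Gs(1,2,5)] norm_on_dist_triangle[OF Bd Gs(2,3,5)]
      norm_on_dist_triangle[OF Bd Gs(3,4,5)] by linarith
  then show ?thesis
    using 1 2 3 4 unfolding G_def by linarith
qed

text \<open>The moving indices depend only on d and s, so the equations for u and u_n acquire the
  same ones and their integrands can be compared pointwise.\<close>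

lemma solution_integral:
  assumes v: "solution S \<alpha>0 lam r y V D v" and D: "nonlinearity S T \<beta> r C2 C3 y D"
    and V: "evolution_system S T \<beta> C1 V" and y: "y \<in> spc S (lo S)"
    and t: "0 \<le> t" "\<alpha>0 + \<eta> + lam * t < d" "d \<le> hi S"
  obtains I where "v t = V t 0 (lo S) \<alpha>0 y + I"
    "has_riemann_integral_on (spc S d) (nrm S d)
      (\<lambda>s. V t s (d - (d - \<alpha>0 - \<eta> - lam * s) / 4) d
        (D s (d - 2 * ((d - \<alpha>0 - \<eta> - lam * s) / 4)) (d - (d - \<alpha>0 - \<eta> - lam * s) / 4) (v s))) I 0 t"
proof -
  have td: "\<alpha>0 + lam * t < d"
    using t \<eta> by simp
  have "d \<in> {\<alpha>0<..hi S}" "t \<in> {0..<(d - \<alpha>0) / lam}"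
    using t index_gt[OF t(1) td] td lam by (auto simp: field_simps)
  then obtain a b I where ab: "a < b" "b < d" "t < (a - \<alpha>0) / lam"
      and I: "has_riemann_integral_on (spc S d) (nrm S d) (\<lambda>s. V t s b d (D s a b (v s))) I 0 t"
      "v t = V t 0 (lo S) d y + I"
    using v unfolding solution_def by blast
  have tT: "t < T"
    using td t by (intro time_lt) simp
  have at: "\<alpha>0 + lam * t < a"
    using ab lam by (simp add: field_simps)
  \<comment> \<open>The initial term is viewed at \<alpha>0, where its error is controlled for all d
    at once.\<close>
  have "V t 0 (lo S) d y = V t 0 (lo S) \<alpha>0 y"
    using t tT y \<alpha>0 index_gt[OF t(1) td] by (intro evolution_indep[OF scale V]) auto
  with I(2) have "v t = V t 0 (lo S) \<alpha>0 y + I"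
    by simp
  moreover have "V t s b d (D s a b (v s)) = V t s (d - (d - \<alpha>0 - \<eta> - lam * s) / 4) d
        (D s (d - 2 * ((d - \<alpha>0 - \<eta> - lam * s) / 4)) (d - (d - \<alpha>0 - \<eta> - lam * s) / 4) (v s))"
    if s: "s \<in> {0..t}" for s
  proof -
    define h where "h = (d - \<alpha>0 - \<eta> - lam * s) / 4"
    have "lam * s \<le> lam * t"
      using s lam by simp
    then have h: "0 < h" "\<alpha>0 + lam * s < d - 2 * h" "\<alpha>0 + lam * s < a"
      using t \<eta> at unfolding h_def by (simp_all add: field_simps)
    have s0: "0 \<le> s"
      using s by simp
    have "V t s b d (D s a b (v s)) = V t s (d - h) d (D s (d - 2 * h) (d - h) (v s))"
      using s tT ab t h index_gt[OF s0 h(2)] index_gt[OF s0 h(3)]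
      by (intro evolution_nonlinearity_indep[OF scale D _ _ V] solution_in_ball[OF v]) auto
    then show ?thesis
      by (simp add: h_def)
  qed
  then have "has_riemann_integral_on (spc S d) (nrm S d)
      (\<lambda>s. V t s (d - (d - \<alpha>0 - \<eta> - lam * s) / 4) d
        (D s (d - 2 * ((d - \<alpha>0 - \<eta> - lam * s) / 4)) (d - (d - \<alpha>0 - \<eta> - lam * s) / 4) (v s))) I 0 t"
    using I(1) by (intro has_riemann_integral_on_cong[OF _ I(1)]) auto
  ultimately show thesis
    by (rule that)
qed

text \<open>The integrand bound is of order -1-\<gamma> in the gap, so its integral is of order
  -\<gamma>, precisely what the weight compensates.\<close>

lemma weighted_distance_step:
  assumes e: "0 < e" "e \<le> 1"
    and K: "0 \<le> K" "\<And>s a. 0 \<le> s \<Longrightarrow> \<alpha>0 + \<eta> + lam * s \<le> a \<Longrightarrow> a \<le> hi S \<Longrightarrow> nrm S a (u s - x) \<le> K"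
    and init: "\<forall>t\<in>{0..Tm}. nrm S \<alpha>0 (Us n t 0 (lo S) \<alpha>0 (xs n) - U t 0 (lo S) \<alpha>0 x) < e"
    and evol: "\<forall>s\<in>{0..Tm}. \<forall>t d a b.
      s \<le> t \<longrightarrow> t \<le> Tm \<longrightarrow> \<alpha>0 + \<eta> + lam * s < d \<longrightarrow> d \<le> hi S \<longrightarrow>
      \<alpha>0 + lam * s < a \<longrightarrow> a < b \<longrightarrow> b < d \<longrightarrow>
      nrm S d (Us n t s b d (B s a b (u s)) - U t s b d (B s a b (u s))) < e"
    and nonlin: "\<forall>s\<in>{0..Tm}. \<forall>t d a b.
      s \<le> t \<longrightarrow> t \<le> Tm \<longrightarrow> \<alpha>0 + \<eta> + lam * s < d \<longrightarrow> d \<le> hi S \<longrightarrow>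
      \<alpha>0 + lam * s < a \<longrightarrow> a < b \<longrightarrow> b < d \<longrightarrow>
      nrm S d (Us n t s b d (Bs n s a b (pull (1 - e) s)) - Us n t s b d (B s a b (pull (1 - e) s))) < e"
    and xn: "ereal (nrm S (lo S) (xs n - x)) \<le> ereal (1 - (1 - e)) * r"
    and M: "0 \<le> M" "\<And>d t. 0 \<le> t \<Longrightarrow> \<alpha>0 + \<eta> + lam * t < d \<Longrightarrow> d \<le> hi S \<Longrightarrow>
      (d - \<alpha>0 - \<eta> - lam * t) powr \<gamma> * nrm S d (us n t - u t) \<le> M"
    and t: "0 \<le> t" and d: "\<alpha>0 + \<eta> + lam * t < d" "d \<le> hi S"
  defines "L \<equiv> hi S - \<alpha>0"
  shows "(d - \<alpha>0 - \<eta> - lam * t) powr \<gamma> * nrm S d (us n t - u t)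
    \<le> e * (L powr \<gamma> + (8 * (C1 * C2) * K * L powr \<gamma> + 2 * L powr (1 + \<gamma>)) / (lam * \<gamma>))
      + 2 powr (2 + \<gamma>) * C1 * C2 / (lam * \<gamma>) * M"
proof -
  define \<rho> where "\<rho> s = d - \<alpha>0 - \<eta> - lam * s" for s
  \<comment> \<open>The common coefficient of \<rho>^(-1-\<gamma>): after division by \<lambda>
    \<gamma> its first part becomes the contraction term, its second part the consistency
    error.\<close>
  define A where "A = 2 powr (2 + \<gamma>) * (C1 * C2) * M
    + e * (8 * (C1 * C2) * K * L powr \<gamma> + 2 * L powr (1 + \<gamma>))"
  have A: "0 \<le> A"
    using e K M C1 C2 by (simp add: A_def)
  have td: "\<alpha>0 + lam * t < d"
    using d \<eta> by simp
  have lo: "lo S \<le> d" "\<alpha>0 \<le> d"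
    using index_gt[OF t td] by auto
  note Bd = banach[OF lo(1) d(2)]
  have t': "t \<le> Tm"
    using d le_Tm by auto
  then have t'': "t < T"
    using Tm by simp
  obtain I where I: "u t = U t 0 (lo S) \<alpha>0 x + I"
      "has_riemann_integral_on (spc S d) (nrm S d)
        (\<lambda>s. U t s (d - \<rho> s / 4) d (B s (d - 2 * (\<rho> s / 4)) (d - \<rho> s / 4) (u s))) I 0 t"
    using solution_integral[OF u(1) B U x t d] unfolding \<rho>_def by blast
  obtain J where J: "us n t = Us n t 0 (lo S) \<alpha>0 (xs n) + J"
      "has_riemann_integral_on (spc S d) (nrm S d)
        (\<lambda>s. Us n t s (d - \<rho> s / 4) d (Bs n s (d - 2 * (\<rho> s / 4)) (d - \<rho> s / 4) (us n s))) J 0 t"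
    using solution_integral[OF us(1) Bs Us xs t d] unfolding \<rho>_def by blast
  have \<rho>: "0 < \<rho> s" "\<rho> s \<le> L" if "s \<in> {0..t}" for s
  proof -
    have "lam * s \<le> lam * t" "0 \<le> lam * s"
      using that lam by simp_all
    then show "0 < \<rho> s" "\<rho> s \<le> L"
      using d \<eta> by (auto simp: \<rho>_def L_def)
  qed
  have int: "((\<lambda>s. A * \<rho> s powr (- 1 - \<gamma>)) has_integral
      A * (\<rho> t powr - \<gamma> / (lam * \<gamma>) - \<rho> 0 powr - \<gamma> / (lam * \<gamma>))) {0..t}"
    using has_integral_mult_right[OF has_integral_powr_linear[OF \<gamma> lam(1) t, of "d - \<alpha>0 - \<eta>"], of A] d
    by (simp add: \<rho>_def)
  have "nrm S d (J - I) \<le> A * (\<rho> t powr - \<gamma> / (lam * \<gamma>) - \<rho> 0 powr - \<gamma> / (lam * \<gamma>))"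
  proof (rule riemann_integral_diff_bound[OF Bd J(2) I(2) int])
    fix s assume s: "s \<in> {0..t}"
    then have "nrm S d (Us n t s (d - \<rho> s / 4) d (Bs n s (d - 2 * (\<rho> s / 4)) (d - \<rho> s / 4) (us n s))
        - U t s (d - \<rho> s / 4) d (B s (d - 2 * (\<rho> s / 4)) (d - \<rho> s / 4) (u s)))
      \<le> C1 * C2 / (\<rho> s / 4) * (M * (2 * (\<rho> s / 4)) powr - \<gamma> + e * K) + e
        + C1 * C2 / (\<rho> s / 4) * (e * K) + e"
      by (intro integrand_close[OF e K evol nonlin xn M(2) _ _ d]) (auto simp: \<rho>_def)
    also have "\<dots> \<le> A * \<rho> s powr (- 1 - \<gamma>)"
      using contraction_majorant[OF \<rho>[OF s] \<gamma>, of "C1 * C2" K e M] C1 C2 K e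
      by (simp add: A_def)
    finally show "nrm S d (Us n t s (d - \<rho> s / 4) d (Bs n s (d - 2 * (\<rho> s / 4)) (d - \<rho> s / 4) (us n s))
        - U t s (d - \<rho> s / 4) d (B s (d - 2 * (\<rho> s / 4)) (d - \<rho> s / 4) (u s)))
      \<le> A * \<rho> s powr (- 1 - \<gamma>)" .
  qed
  \<comment> \<open>The subtracted contribution of the primitive at s = 0 is nonnegative and is
    dropped.\<close>
  also have "\<dots> \<le> A * (\<rho> t powr - \<gamma> / (lam * \<gamma>))"
    using A lam \<gamma> by (intro mult_left_mono) auto
  finally have JI: "nrm S d (J - I) \<le> A * (\<rho> t powr - \<gamma> / (lam * \<gamma>))" .
  have xU: "Us n t 0 (lo S) \<alpha>0 (xs n) \<in> spc S \<alpha>0" "U t 0 (lo S) \<alpha>0 x \<in> spc S \<alpha>0"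
    using evolution_in_spc[OF scale Us _ t t'', of "lo S" \<alpha>0] evolution_in_spc[OF scale U _ t t'', of "lo S" \<alpha>0]
      x xs \<alpha>0 by auto
  have xU0: "Us n t 0 (lo S) \<alpha>0 (xs n) - U t 0 (lo S) \<alpha>0 x \<in> spc S \<alpha>0"
    using xU \<alpha>0 by (intro banach_diff[OF banach]) auto
  have "nrm S d (Us n t 0 (lo S) \<alpha>0 (xs n) - U t 0 (lo S) \<alpha>0 x)
      \<le> nrm S \<alpha>0 (Us n t 0 (lo S) \<alpha>0 (xs n) - U t 0 (lo S) \<alpha>0 x)"
    using xU0 \<alpha>0 lo d by (intro nrm_mono[OF scale]) auto
  also have "\<dots> < e"
    using bspec[OF init, of t] t t' by simp
  finally have init': "nrm S d (Us n t 0 (lo S) \<alpha>0 (xs n) - U t 0 (lo S) \<alpha>0 x) < e" .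
  have "I \<in> spc S d" "J \<in> spc S d"
    using I J unfolding has_riemann_integral_on_def by auto
  moreover have "Us n t 0 (lo S) \<alpha>0 (xs n) - U t 0 (lo S) \<alpha>0 x \<in> spc S d"
    using spc_mono[OF scale _ lo(2) d(2) xU0] \<alpha>0 by simp
  ultimately have "nrm S d (us n t - u t) \<le> e + A * (\<rho> t powr - \<gamma> / (lam * \<gamma>))"
    using norm_on_triangle[OF Bd, of "Us n t 0 (lo S) \<alpha>0 (xs n) - U t 0 (lo S) \<alpha>0 x" "J - I"]
      banach_diff[OF Bd, of J I] init' JI unfolding I(1) J(1) by (simp add: algebra_simps)
  then have "\<rho> t powr \<gamma> * nrm S d (us n t - u t)
      \<le> \<rho> t powr \<gamma> * (e + A * (\<rho> t powr - \<gamma> / (lam * \<gamma>)))"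
    by (intro mult_left_mono) auto
  also have "\<dots> = \<rho> t powr \<gamma> * e + A / (lam * \<gamma>)"
    using \<rho>[of t] t by (simp add: algebra_simps powr_minus)
  also have "\<rho> t powr \<gamma> * e \<le> L powr \<gamma> * e"
    using \<rho>[of t] t \<gamma> e by (intro mult_right_mono powr_mono2) auto
  finally show ?thesis
    by (simp add: \<rho>_def A_def algebra_simps add_divide_distrib)
qed

text \<open>The shift by \<eta> only lowers the weight, because \<gamma> > 0, so finiteness of both
  weighted norms suffices. The bound may depend on n: absorption takes place for each n
  separately.\<close>

lemma weighted_distance_finite:
  obtains W where "\<And>d t. 0 \<le> t \<Longrightarrow> \<alpha>0 + \<eta> + lam * t < d \<Longrightarrow> d \<le> hi S \<Longrightarrow>
    (d - \<alpha>0 - \<eta> - lam * t) powr \<gamma> * nrm S d (us n t - u t) \<le> W"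
proof -
  obtain W where W: "\<And>a t. 0 \<le> t \<Longrightarrow> \<alpha>0 + lam * t < a \<Longrightarrow> a \<le> hi S \<Longrightarrow>
      (a - \<alpha>0 - lam * t) powr \<gamma> * nrm S a (u t) \<le> W"
    using weighted_norm_bound[OF u(2) lam(1)] by blast
  obtain W' where W': "\<And>a t. 0 \<le> t \<Longrightarrow> \<alpha>0 + lam * t < a \<Longrightarrow> a \<le> hi S \<Longrightarrow>
      (a - \<alpha>0 - lam * t) powr \<gamma> * nrm S a (us n t) \<le> W'"
    using weighted_norm_bound[OF us(2) lam(1)] by blast
  show thesis
  proof (rule that)
    fix d t assume t: "0 \<le> t" and d: "\<alpha>0 + \<eta> + lam * t < d" "d \<le> hi S"
    have td: "\<alpha>0 + lam * t < d"
      using d \<eta> by simp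
    have "lo S \<le> d"
      using index_gt[OF t td] by simp
    note Bd = banach[OF this d(2)]
    have in_d: "us n t \<in> spc S d" "u t \<in> spc S d"
      using us_in_spc u_in_spc t td d by auto
    have "(d - \<alpha>0 - \<eta> - lam * t) powr \<gamma> * nrm S d (us n t - u t)
        \<le> (d - \<alpha>0 - lam * t) powr \<gamma> * (nrm S d (us n t) + nrm S d (u t))"
      using d \<eta> \<gamma> in_d norm_on_nonneg[OF Bd banach_diff[OF Bd in_d]] norm_on_triangle_minus[OF Bd in_d]
      by (intro mult_mono powr_mono2) auto
    also have "\<dots> \<le> W' + W"
      using W[OF t td d(2)] W'[OF t td d(2)] by (simp add: distrib_left)
    finally show "(d - \<alpha>0 - \<eta> - lam * t) powr \<gamma> * nrm S d (us n t - u t) \<le> W' + W" .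
  qed
qed

lemma weighted_distance_tendsto:
  assumes \<delta>: "0 < \<delta>"
  shows "\<forall>\<^sub>F n in sequentially. \<forall>d t. 0 \<le> t \<longrightarrow> \<alpha>0 + \<eta> + lam * t < d \<longrightarrow> d \<le> hi S \<longrightarrow>
    (d - \<alpha>0 - \<eta> - lam * t) powr \<gamma> * nrm S d (us n t - u t) \<le> \<delta>"
proof -
  define q where "q = 2 powr (2 + \<gamma>) * C1 * C2 / (lam * \<gamma>)"
  have q: "0 \<le> q" "q < 1"
    using contraction C1 C2 lam \<gamma> by (simp_all add: q_def)
  obtain K where K: "0 \<le> K"
    "\<And>s a. 0 \<le> s \<Longrightarrow> \<alpha>0 + \<eta> + lam * s \<le> a \<Longrightarrow> a \<le> hi S \<Longrightarrow> nrm S a (u s - x) \<le> K"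
    using u_bounded by blast
  define L where "L = hi S - \<alpha>0"
  define Q where "Q = L powr \<gamma> + (8 * (C1 * C2) * K * L powr \<gamma> + 2 * L powr (1 + \<gamma>)) / (lam * \<gamma>)"
  have "0 < L powr \<gamma>"
    using \<alpha>0 by (simp add: L_def)
  then have Q: "0 < Q"
    unfolding Q_def using K C1 C2 lam \<gamma> by (intro add_pos_nonneg) auto
  \<comment> \<open>\<open>K\<close>, hence \<open>Q\<close>, is fixed before e. The second entry
    makes e Q / (1 - q) \<le> \<delta>, and the cap at 1 keeps the pull factor 1 - e
    nonnegative.\<close>
  define e where "e = min 1 (\<delta> * (1 - q) / Q)"
  have e: "0 < e" "e \<le> 1" "e * Q \<le> \<delta> * (1 - q)"
    using \<delta> Q q min.cobounded2[of 1 "\<delta> * (1 - q) / Q"]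
    by (auto simp: e_def pos_le_divide_eq[symmetric])
  have \<kappa>: "0 \<le> 1 - e" "1 - e < 1"
    using e by auto
  show ?thesis
    using eventually_initial_close[OF e(1)] eventually_evolution_close[OF e(1)]
      eventually_nonlinearity_close[OF e(1) \<kappa>] eventually_xs_close[OF \<kappa>]
  proof (eventually_elim, intro allI impI)
    fix n d t
    assume n: "\<forall>t\<in>{0..Tm}. nrm S \<alpha>0 (Us n t 0 (lo S) \<alpha>0 (xs n) - U t 0 (lo S) \<alpha>0 x) < e"
      "\<forall>s\<in>{0..Tm}. \<forall>t d a b.
        s \<le> t \<longrightarrow> t \<le> Tm \<longrightarrow> \<alpha>0 + \<eta> + lam * s < d \<longrightarrow> d \<le> hi S \<longrightarrow>
        \<alpha>0 + lam * s < a \<longrightarrow> a < b \<longrightarrow> b < d \<longrightarrow>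
        nrm S d (Us n t s b d (B s a b (u s)) - U t s b d (B s a b (u s))) < e"
      "\<forall>s\<in>{0..Tm}. \<forall>t d a b.
        s \<le> t \<longrightarrow> t \<le> Tm \<longrightarrow> \<alpha>0 + \<eta> + lam * s < d \<longrightarrow> d \<le> hi S \<longrightarrow>
        \<alpha>0 + lam * s < a \<longrightarrow> a < b \<longrightarrow> b < d \<longrightarrow>
        nrm S d (Us n t s b d (Bs n s a b (pull (1 - e) s)) - Us n t s b d (B s a b (pull (1 - e) s))) < e"
      "ereal (nrm S (lo S) (xs n - x)) \<le> ereal (1 - (1 - e)) * r"
      and dt: "0 \<le> t" "\<alpha>0 + \<eta> + lam * t < d" "d \<le> hi S"
    obtain W where W: "\<And>d t. 0 \<le> t \<Longrightarrow> \<alpha>0 + \<eta> + lam * t < d \<Longrightarrow> d \<le> hi S \<Longrightarrow>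
        (d - \<alpha>0 - \<eta> - lam * t) powr \<gamma> * nrm S d (us n t - u t) \<le> W"
      using weighted_distance_finite by blast
    define f where "f = (\<lambda>(d, t). (d - \<alpha>0 - \<eta> - lam * t) powr \<gamma> * nrm S d (us n t - u t))"
    define Z where "Z = {(d, t). 0 \<le> t \<and> \<alpha>0 + \<eta> + lam * t < d \<and> d \<le> hi S}"
    have "f (d, t) \<le> e * Q / (1 - q)"
    proof (rule absorb_bound[where A = Z])
      show "f i \<le> W" if "i \<in> Z" for i
        using W that by (auto simp: f_def Z_def)
      show "(d, t) \<in> Z"
        using dt by (simp add: Z_def)
      fix M i assume M: "0 \<le> M" "\<And>i. i \<in> Z \<Longrightarrow> f i \<le> M" and "i \<in> Z"
      then obtain d' t' where i: "i = (d', t')" "0 \<le> t'" "\<alpha>0 + \<eta> + lam * t' < d'" "d' \<le> hi S"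
        by (auto simp: Z_def)
      show "f i \<le> e * Q + q * M"
        using weighted_distance_step[OF e(1,2) K n M(1) _ i(2-4)] M(2)
        by (force simp: f_def Z_def i(1) Q_def q_def L_def)
    qed (use e Q q in auto)
    also have "\<dots> \<le> \<delta>"
      using e q by (simp add: field_simps)
    finally show "(d - \<alpha>0 - \<eta> - lam * t) powr \<gamma> * nrm S d (us n t - u t) \<le> \<delta>"
      by (simp add: f_def)
  qed
qed

end

end

section \<open>From the shifted weight to uniform convergence\<close>

theorem theorem3p1:
  fixes S :: "'a::real_vector scale"
    and T \<beta> C1 C2 C3 \<alpha>0 \<gamma> lam :: real
    and C :: "real \<Rightarrow> real"
    and r :: ereal
    and x :: 'a and xs :: "nat \<Rightarrow> 'a"
    and U :: "real \<Rightarrow> real \<Rightarrow> 'a scale_map" and Us :: "nat \<Rightarrow> real \<Rightarrow> real \<Rightarrow> 'a scale_map"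
    and B :: "real \<Rightarrow> 'a scale_map" and Bs :: "nat \<Rightarrow> real \<Rightarrow> 'a scale_map"
    and u :: "real \<Rightarrow> 'a" and us :: "nat \<Rightarrow> real \<Rightarrow> 'a"
  assumes scale: "banach_scale S"
    and T: "T > 0"
    and params: "(\<beta> = 0 \<and> 0 < r) \<or> (0 < \<beta> \<and> \<beta> < 1/2 \<and> r = \<infinity>)"
    and pos: "C1 > 0" "C2 > 0" "C3 > 0"
    and C1_space: "x \<in> spc S (lo S)" "\<And>n. xs n \<in> spc S (lo S)"
    and C1_lim: "limitin (scale_top S (lo S)) xs x sequentially"
    and C2: "evolution_system S T \<beta> C1 U" "\<And>n. evolution_system S T \<beta> C1 (Us n)"
    and C3: "\<And>\<alpha>. \<alpha> \<in> {lo S<..hi S} \<Longrightarrow> C \<alpha> > 0 \<and>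
        (\<forall>n. \<forall>s\<in>{0..<T}. \<forall>t\<in>{0..<T}.
          nrm S \<alpha> (Us n t 0 (lo S) \<alpha> (xs n) - Us n s 0 (lo S) \<alpha> (xs n)) \<le> C \<alpha> * \<bar>t - s\<bar>)"
    and C4: "nonlinearity S T \<beta> r C2 C3 x B" "\<And>n. nonlinearity S T \<beta> r C2 C3 (xs n) (Bs n)"
    and C5_U: "\<And>\<alpha>' \<alpha> z K \<epsilon>. \<lbrakk>lo S \<le> \<alpha>'; \<alpha>' < \<alpha>; \<alpha> \<le> hi S; z \<in> spc S \<alpha>';
        compact K; K \<subseteq> time_simplex T; \<epsilon> > 0\<rbrakk> \<Longrightarrow>
        \<forall>\<^sub>F n in sequentially. \<forall>(t, s)\<in>K.
          nrm S \<alpha> (Us n t s \<alpha>' \<alpha> z - U t s \<alpha>' \<alpha> z) < \<epsilon>"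
    and C5_B: "\<And>\<alpha>' \<alpha> z K \<epsilon>. \<lbrakk>lo S \<le> \<alpha>'; \<alpha>' < \<alpha>; \<alpha> \<le> hi S; z \<in> scale_ball S \<alpha>' x r;
        compact K; K \<subseteq> {0..<T}; \<epsilon> > 0\<rbrakk> \<Longrightarrow>
        \<forall>\<^sub>F n in sequentially. z \<in> scale_ball S \<alpha>' (xs n) r \<longrightarrow>
          (\<forall>t\<in>K. nrm S \<alpha> (Bs n t \<alpha>' \<alpha> z - B t \<alpha>' \<alpha> z) < \<epsilon>)"
    and \<alpha>0: "lo S < \<alpha>0" "\<alpha>0 < hi S"
    and \<gamma>: "\<beta> < \<gamma>" "\<gamma> < 1 - \<beta>"
    and lam: "ereal lam > lambda1 S \<beta> C1 C2 C3 (C \<alpha>0) x xs \<alpha>0 \<gamma> r T"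
    and u: "solution S \<alpha>0 lam r x U B u" "weighted_norm S \<alpha>0 lam \<gamma> u < \<infinity>"
    and us: "\<And>n. solution S \<alpha>0 lam r (xs n) (Us n) (Bs n) (us n)"
            "\<And>n. weighted_norm S \<alpha>0 lam \<gamma> (us n) < \<infinity>"
  shows "\<forall>\<alpha>\<in>{\<alpha>0<..hi S}. \<forall>T'\<in>{0<..<(\<alpha> - \<alpha>0) / lam}.
    (\<lambda>n. SUP t\<in>{0..T'}. ereal (nrm S \<alpha> (us n t - u t))) \<longlonglongrightarrow> 0"
proof (intro ballI)
  fix \<alpha> T' assume \<alpha>: "\<alpha> \<in> {\<alpha>0<..hi S}" and T': "T' \<in> {0<..<(\<alpha> - \<alpha>0) / lam}"
  \<comment> \<open>The first and third entries of \<open>lambda0\<close> at x.\<close>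
  have bounds: "(hi S - lo S) / T < lam"
    "4 powr (1 - \<beta>) * C2 * (hi S - \<alpha>0) powr \<beta> / (\<gamma> * (1 + nrm S (lo S) x))
      + 2 powr (2 + \<gamma>) * C1 * C2 / \<gamma> < lam"
  proof -
    have "lambda0 S \<beta> C1 C2 C3 (C \<alpha>0) x \<alpha>0 \<gamma> r T < ereal lam"
      using lam unfolding lambda1_def by simp
    then show "(hi S - lo S) / T < lam"
      "4 powr (1 - \<beta>) * C2 * (hi S - \<alpha>0) powr \<beta> / (\<gamma> * (1 + nrm S (lo S) x))
        + 2 powr (2 + \<gamma>) * C1 * C2 / \<gamma> < lam"
      unfolding lambda0_def by (subst (asm) Max_less_iff; force)+
  qed
  have r0: "0 < r" and \<gamma>0: "0 < \<gamma>"
    using params \<gamma> by auto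
  have lam0: "0 < lam"
    using bounds(1) T \<alpha>0 divide_pos_pos[of "hi S - lo S" T] by linarith
  have "0 \<le> nrm S (lo S) x"
    using \<alpha>0 C1_space by (intro norm_on_nonneg[OF banach_space_on_spc[OF scale]]) auto
  \<comment> \<open>The first summand of the third entry is nonnegative, so the second alone lies
    below \<open>lam\<close>.\<close>
  then have "0 \<le> 4 powr (1 - \<beta>) * C2 * (hi S - \<alpha>0) powr \<beta> / (\<gamma> * (1 + nrm S (lo S) x))"
    using pos \<gamma>0 by (intro divide_nonneg_nonneg mult_nonneg_nonneg) auto
  then have "2 powr (2 + \<gamma>) * C1 * C2 / \<gamma> < lam"
    using bounds(2) by linarith
  then have contr: "2 powr (2 + \<gamma>) * C1 * C2 < lam * \<gamma>"
    using \<gamma>0 by (simp add: field_simps)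
  have "hi S - lo S < lam * T"
    using bounds(1) T by (simp add: field_simps)
  then have lamT: "hi S - \<alpha>0 < lam * T"
    using \<alpha>0 by simp
  interpret approx: scale_approximation S T \<beta> C1 C2 C3 \<alpha>0 \<gamma> lam r x xs U Us B Bs u us
    by (rule scale_approximation.intro)
      (fact scale r0 pos \<alpha>0 \<gamma>0 lam0 lamT contr C1_space C1_lim C2 C4 C5_U C5_B u us)+
  \<comment> \<open>Half of the gap left at T': after the shift, the other half bounds the gap from
    below by \<eta> on all of [0, T'].\<close>
  define \<eta> where "\<eta> = (\<alpha> - \<alpha>0 - lam * T') / 2"
  have "lam * T' < \<alpha> - \<alpha>0" "0 < lam * T'"
    using T' lam0 by (auto simp: field_simps)
  then have \<eta>: "0 < \<eta>" "\<alpha>0 + \<eta> < hi S"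
    using \<alpha> unfolding \<eta>_def by (auto simp: field_simps)
  have small: "\<forall>\<^sub>F n in sequentially. (SUP t\<in>{0..T'}. ereal (nrm S \<alpha> (us n t - u t))) \<le> ereal \<delta>"
    if \<delta>: "0 < \<delta>" for \<delta>
    \<comment> \<open>The weight on [0, T'] is at least \<eta>^\<gamma>, and dividing by it leaves
      \<delta>.\<close>
    using approx.weighted_distance_tendsto[OF \<eta>, of "\<delta> * \<eta> powr \<gamma>"]
  proof (rule eventually_mono[OF _ SUP_least])
    show "0 < \<delta> * \<eta> powr \<gamma>"
      using \<delta> \<eta> by simp
  next
    fix n t
    assume n: "\<forall>d t. 0 \<le> t \<longrightarrow> \<alpha>0 + \<eta> + lam * t < d \<longrightarrow> d \<le> hi S \<longrightarrow>
        (d - \<alpha>0 - \<eta> - lam * t) powr \<gamma> * nrm S d (us n t - u t) \<le> \<delta> * \<eta> powr \<gamma>"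
      and t: "t \<in> {0..T'}"
    have "lam * t \<le> lam * T'"
      using t lam0 by simp
    then have ge: "\<eta> \<le> \<alpha> - \<alpha>0 - \<eta> - lam * t"
      unfolding \<eta>_def by (simp add: field_simps)
    then have t\<alpha>: "\<alpha>0 + lam * t < \<alpha>" "\<alpha>0 + \<eta> + lam * t < \<alpha>"
      using \<eta> by linarith+
    have B\<alpha>: "banach_space_on (spc S \<alpha>) (nrm S \<alpha>)"
      using \<alpha> \<alpha>0 by (intro approx.banach) auto
    have "0 \<le> nrm S \<alpha> (us n t - u t)"
      using t t\<alpha> \<alpha> by (intro norm_on_nonneg[OF B\<alpha>] banach_diff[OF B\<alpha>] approx.us_in_spc approx.u_in_spc) auto
    then have "\<eta> powr \<gamma> * nrm S \<alpha> (us n t - u t)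
        \<le> (\<alpha> - \<alpha>0 - \<eta> - lam * t) powr \<gamma> * nrm S \<alpha> (us n t - u t)"
      using ge \<eta> \<gamma>0 by (intro mult_right_mono powr_mono2) auto
    also have "\<dots> \<le> \<delta> * \<eta> powr \<gamma>"
      using n t t\<alpha> \<alpha> by auto
    finally show "ereal (nrm S \<alpha> (us n t - u t)) \<le> ereal \<delta>"
      using \<eta> by (simp add: mult.commute)
  qed
  \<comment> \<open>In \<open>ereal\<close> an empty supremum is -\<infinity>; the time 0 witnesses
    that the index set is nonempty.\<close>
  have nonneg: "0 \<le> (SUP t\<in>{0..T'}. ereal (nrm S \<alpha> (us n t - u t)))" for n
  proof (rule SUP_upper2)
    show "0 \<in> {0..T'}"
      using T' by simp
    have B\<alpha>: "banach_space_on (spc S \<alpha>) (nrm S \<alpha>)"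
      using \<alpha> \<alpha>0 by (intro approx.banach) auto
    show "0 \<le> ereal (nrm S \<alpha> (us n 0 - u 0))"
      using \<alpha> unfolding ereal_less_eq
      by (intro norm_on_nonneg[OF B\<alpha>] banach_diff[OF B\<alpha>] approx.us_in_spc approx.u_in_spc) auto
  qed
  show "(\<lambda>n. SUP t\<in>{0..T'}. ereal (nrm S \<alpha> (us n t - u t))) \<longlonglongrightarrow> 0"
  proof (rule order_tendstoI)
    fix b :: ereal assume "b < 0"
    then show "\<forall>\<^sub>F n in sequentially. b < (SUP t\<in>{0..T'}. ereal (nrm S \<alpha> (us n t - u t)))"
      by (intro always_eventually allI) (erule less_le_trans[OF _ nonneg])
  next
    fix b :: ereal assume "0 < b"
    then obtain \<delta> where \<delta>: "0 < ereal \<delta>" "ereal \<delta> < b"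
      using ereal_dense2[of 0 b] by auto
    then have "0 < \<delta>"
      by simp
    from small[OF this] show "\<forall>\<^sub>F n in sequentially. (SUP t\<in>{0..T'}. ereal (nrm S \<alpha> (us n t - u t))) < b"
      by (rule eventually_mono) (erule le_less_trans[OF _ \<delta>(2)])
  qed
qed

end
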